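(* Let $X\subset\mathbb{P}^4_{\mathbb{C}}$ be a smooth hypersurface of degree $d\geq 2$. Then for every integer $m\geq 1$, $$H^0(X,E_{2,m}T_X^* )=0 .$$
   Context: For a complex manifold $X$ of dimension $n$ and integers $k\ge1$, $m\ge 0$, $E_{k,m}T_X^*$ denotes Demailly's holomorphic vector bundle of invariant jet differentials of order $k$ and degree $m$. Let $J_k\to X$ be the bundle of $k$-jets of germs of holomorphic curves $f:(\mathbb{C},0)\to X$. In local coordinates $z=(z_1,\dots,z_n)$, a local section of $E_{k,m}T_X^*$ is a polynomial $$P=\sum_{|\alpha_1|+2|\alpha_2|+\cdots+k|\alpha_k|=m}R_\alpha(z)\,dz^{\alpha_1}(d^2z)^{\alpha_2}\cdots (d^kz)^{\alpha_k},\qquad \alpha_j\in\mathbb{N}^n,$$ with holomorphic coefficients $R_\alpha$, acting on $k$-jets of curves by $P(f',\dots,f^{(k)})=\sum_\alpha R_\alpha(f)(f')^{\alpha_1}\cdots(f^{(k)})^{\alpha_k}$, and invariant under reparametrization: for every germ $\varphi$ of biholomorphism of $(\mathbb{C},0)$, $$P((f\circ\varphi)',\dots,(f\circ\varphi)^{(k)})_t=\varphi'(t)^m\,P(f',\dots,f^{(k)})_{\varphi(t)} .$$ *)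

theory Defs
  imports "HOL-Analysis.Analysis"
begin

section \<open>Holomorphic atlases\<close>

text \<open>Holomorphy on an open subset of \<open>\<complex>\<^sup>n\<close>: complex differentiability at every point.\<close>

definition holo_on :: "(complex^'n \<Rightarrow> complex) \<Rightarrow> (complex^'n) set \<Rightarrow> bool" where
  "holo_on f S \<longleftrightarrow>
     (\<forall>z\<in>S. \<exists>D. (f has_derivative D) (at z) \<and> (\<forall>c v. D (c *s v) = c * D v))"

definition holo_map_on :: "(complex^'n \<Rightarrow> complex^'m) \<Rightarrow> (complex^'n) set \<Rightarrow> bool" where
  "holo_map_on f S \<longleftrightarrow> (\<forall>i. holo_on (\<lambda>z. f z $ i) S)"

type_synonym ('p, 'n) chart = "'p set \<times> ('p \<Rightarrow> complex^'n)"

text \<open>A manifold is given by a holomorphic atlas; its underlying set and its topology are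
  those determined by the atlas.\<close>

definition points :: "('p, 'n) chart set \<Rightarrow> 'p set" where
  "points A = (\<Union>(U, \<phi>)\<in>A. U)"

fun holo_transition :: "('p, 'n::finite) chart \<Rightarrow> ('p, 'n) chart \<Rightarrow> bool" where
  "holo_transition (U, \<phi>) (V, \<psi>) \<longleftrightarrow>
     open (\<phi> ` (U \<inter> V)) \<and> holo_map_on (\<psi> \<circ> inv_into U \<phi>) (\<phi> ` (U \<inter> V))"

definition max_atlas :: "('p, 'n::finite) chart set \<Rightarrow> ('p, 'n) chart set" where
  "max_atlas A = {(U, \<phi>). U \<subseteq> points A \<and> inj_on \<phi> U \<and> open (\<phi> ` U) \<and>
     (\<forall>c\<in>A. holo_transition (U, \<phi>) c \<and> holo_transition c (U, \<phi>))}"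

text \<open>The charts induced on a submanifold \<open>X\<close> of dimension \<open>CARD('n)\<close>: take a chart \<open>\<Phi>\<close> of the
  ambient manifold in which \<open>X\<close> is the vanishing locus of the coordinates outside
  \<open>range \<iota>\<close>, and keep the coordinates in \<open>range \<iota>\<close>.\<close>

definition submanifold_atlas ::
    "('p, 'N::finite) chart set \<Rightarrow> 'p set \<Rightarrow> ('p, 'n::finite) chart set" where
  "submanifold_atlas A X = {(U \<inter> X, \<lambda>p. \<chi> a. \<Phi> p $ \<iota> a) | U \<Phi> (\<iota> :: 'n \<Rightarrow> 'N).
     (U, \<Phi>) \<in> max_atlas A \<and> inj \<iota> \<and>
     \<Phi> ` (U \<inter> X) = {w \<in> \<Phi> ` U. \<forall>j. j \<notin> range \<iota> \<longrightarrow> w $ j = 0}}"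


section \<open>Invariant jet differentials\<close>

text \<open>Germs are represented by total functions; only the values near \<open>0\<close> matter.\<close>

definition curve_germ :: "('p, 'n::finite) chart set \<Rightarrow> (complex \<Rightarrow> 'p) \<Rightarrow> bool" where
  "curve_germ A f \<longleftrightarrow> (\<exists>(U, \<phi>)\<in>A. (\<forall>\<^sub>F t in nhds 0. f t \<in> U) \<and>
     (\<forall>i. (\<lambda>t. \<phi> (f t) $ i) analytic_on {0}))"

definition jet_coord ::
    "('p \<Rightarrow> complex^'n) \<Rightarrow> (complex \<Rightarrow> 'p) \<Rightarrow> nat \<Rightarrow> 'n \<Rightarrow> complex" where
  "jet_coord \<phi> f j i = (deriv ^^ j) (\<lambda>t. \<phi> (f t) $ i) 0"

definition jet ::
    "('p, 'n::finite) chart set \<Rightarrow> nat \<Rightarrow> (complex \<Rightarrow> 'p) \<Rightarrow> (complex \<Rightarrow> 'p) set" where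
  "jet A k f = {g. curve_germ A g \<and> g 0 = f 0 \<and>
     (\<forall>(U, \<phi>)\<in>A. f 0 \<in> U \<longrightarrow> (\<forall>j\<le>k. \<forall>i. jet_coord \<phi> g j i = jet_coord \<phi> f j i))}"

definition jets_over ::
    "('p, 'n::finite) chart set \<Rightarrow> nat \<Rightarrow> 'p set \<Rightarrow> (complex \<Rightarrow> 'p) set set" where
  "jets_over A k W = {jet A k f | f. curve_germ A f \<and> f 0 \<in> W}"

text \<open>Tuples \<open>(\<alpha>\<^sub>1, \<dots>, \<alpha>\<^sub>k)\<close> of multi-indices with \<open>|\<alpha>\<^sub>1| + 2|\<alpha>\<^sub>2| + \<dots> + k|\<alpha>\<^sub>k| = m\<close>, extended by \<open>0\<close>
  outside \<open>{1..k}\<close>.\<close>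

definition jet_exponents :: "nat \<Rightarrow> nat \<Rightarrow> (nat \<Rightarrow> 'n::finite \<Rightarrow> nat) set" where
  "jet_exponents k m = {\<alpha>. (\<forall>j. j \<notin> {1..k} \<longrightarrow> \<alpha> j = (\<lambda>_. 0)) \<and>
     (\<Sum>j=1..k. j * (\<Sum>i\<in>UNIV. \<alpha> j i)) = m}"

lemma finite_jet_exponents: "finite (jet_exponents k m :: (nat \<Rightarrow> 'n::finite \<Rightarrow> nat) set)"
proof -
  let ?B = "{g :: 'n \<Rightarrow> nat. \<forall>i. (i \<in> UNIV \<longrightarrow> g i \<in> {..m}) \<and> (i \<notin> UNIV \<longrightarrow> g i = 0)}"
  have fB: "finite ?B"
    by (rule finite_set_of_finite_funs) auto
  have "jet_exponents k m \<subseteq>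
      {\<alpha> :: nat \<Rightarrow> 'n \<Rightarrow> nat. \<forall>j. (j \<in> {1..k} \<longrightarrow> \<alpha> j \<in> ?B) \<and> (j \<notin> {1..k} \<longrightarrow> \<alpha> j = (\<lambda>_. 0))}"
  proof clarsimp
    fix \<alpha> :: "nat \<Rightarrow> 'n \<Rightarrow> nat" and j
    assume \<alpha>: "\<alpha> \<in> jet_exponents k m"
    show "(Suc 0 \<le> j \<and> j \<le> k \<longrightarrow> (\<forall>i. \<alpha> j i \<le> m)) \<and>
        ((Suc 0 \<le> j \<longrightarrow> \<not> j \<le> k) \<longrightarrow> \<alpha> j = (\<lambda>_. 0))"
    proof (intro conjI impI allI)
      fix i assume j: "Suc 0 \<le> j \<and> j \<le> k"
      have "\<alpha> j i \<le> (\<Sum>i\<in>UNIV. \<alpha> j i)" by (rule member_le_sum) auto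
      also have "\<dots> \<le> j * (\<Sum>i\<in>UNIV. \<alpha> j i)" using j by simp
      also have "\<dots> \<le> (\<Sum>j=1..k. j * (\<Sum>i\<in>UNIV. \<alpha> j i))"
        using j by (intro member_le_sum[where f = "\<lambda>j. j * (\<Sum>i\<in>UNIV. \<alpha> j i)"]) auto
      finally show "\<alpha> j i \<le> m" using \<alpha> by (simp add: jet_exponents_def)
    next
      assume "Suc 0 \<le> j \<longrightarrow> \<not> j \<le> k"
      then show "\<alpha> j = (\<lambda>_. 0)" using \<alpha> by (auto simp: jet_exponents_def)
    qed
  qed
  moreover have "finite {\<alpha> :: nat \<Rightarrow> 'n \<Rightarrow> nat.
      \<forall>j. (j \<in> {1..k} \<longrightarrow> \<alpha> j \<in> ?B) \<and> (j \<notin> {1..k} \<longrightarrow> \<alpha> j = (\<lambda>_. 0))}"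
    by (rule finite_set_of_finite_funs[OF _ fB]) auto
  ultimately show ?thesis by (rule finite_subset)
qed

definition jet_monomial :: "nat \<Rightarrow> (nat \<Rightarrow> 'n::finite \<Rightarrow> nat) \<Rightarrow> (nat \<Rightarrow> 'n \<Rightarrow> complex) \<Rightarrow> complex" where
  "jet_monomial k \<alpha> \<xi> = (\<Prod>j=1..k. \<Prod>i\<in>UNIV. \<xi> j i ^ \<alpha> j i)"

definition biholo_germ :: "(complex \<Rightarrow> complex) \<Rightarrow> bool" where
  "biholo_germ \<phi> \<longleftrightarrow> \<phi> 0 = 0 \<and> (\<exists>S T \<psi>. open S \<and> open T \<and> 0 \<in> S \<and> homeomorphism S T \<phi> \<psi> \<and>
     \<phi> holomorphic_on S \<and> \<psi> holomorphic_on T)"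

text \<open>The sections over an open set \<open>W\<close> of the bundle \<open>E\<^sub>k\<^sub>,\<^sub>m T\<^sup>*\<close> of the manifold with atlas \<open>A\<close>:
  functions on the \<open>k\<close>-jets over \<open>W\<close> which in local coordinates are polynomials of weighted
  degree \<open>m\<close> with holomorphic coefficients, and which are invariant under reparametrization.
  The \<open>k\<close>-jet of \<open>f\<close> at \<open>t\<close> is the jet at \<open>0\<close> of \<open>s \<mapsto> f (t + s)\<close>. Outside the jets over \<open>W\<close> the
  functions take the dummy value \<open>0\<close>, so that sections are equal iff they agree as functions
  on jets.\<close>

definition invariant_jet_differentials ::
    "('p, 'n::finite) chart set \<Rightarrow> nat \<Rightarrow> nat \<Rightarrow> 'p set \<Rightarrow> ((complex \<Rightarrow> 'p) set \<Rightarrow> complex) set" where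
  "invariant_jet_differentials A k m W = {P.
     (\<forall>\<xi>. \<xi> \<notin> jets_over A k W \<longrightarrow> P \<xi> = 0) \<and>
     (\<forall>(U, \<phi>)\<in>A. \<exists>R :: (nat \<Rightarrow> 'n \<Rightarrow> nat) \<Rightarrow> complex^'n \<Rightarrow> complex.
        (\<forall>\<alpha>\<in>jet_exponents k m. holo_on (R \<alpha>) (\<phi> ` (U \<inter> W))) \<and>
        (\<forall>f. curve_germ A f \<and> f 0 \<in> U \<inter> W \<longrightarrow>
           P (jet A k f) =
             (\<Sum>\<alpha>\<in>jet_exponents k m. R \<alpha> (\<phi> (f 0)) * jet_monomial k \<alpha> (jet_coord \<phi> f)))) \<and>
     (\<forall>f \<phi>. curve_germ A f \<and> f 0 \<in> W \<and> biholo_germ \<phi> \<longrightarrow>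
        (\<forall>\<^sub>F t in nhds 0. P (jet A k (\<lambda>s. f (\<phi> (t + s)))) =
           deriv \<phi> t ^ m * P (jet A k (\<lambda>s. f (\<phi> t + s)))))}"

definition global_jet_differentials ::
    "('p, 'n::finite) chart set \<Rightarrow> nat \<Rightarrow> nat \<Rightarrow> ((complex \<Rightarrow> 'p) set \<Rightarrow> complex) set" where
  "global_jet_differentials A k m = invariant_jet_differentials A k m (points A)"


section \<open>Smooth hypersurfaces in projective space\<close>

definition proj_space :: "(complex^'N) set set" where
  "proj_space = {L. vec.subspace L \<and> vec.dim L = 1}"

text \<open>The affine chart \<open>[z] \<mapsto> (z\<^sub>j / z\<^sub>i)\<^sub>j\<^sub>\<noteq>\<^sub>i\<close> on \<open>z\<^sub>i \<noteq> 0\<close>, the indices \<open>j \<noteq> i\<close> being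
  enumerated by a bijection \<open>\<sigma>\<close>.\<close>

definition affine_rep :: "'N \<Rightarrow> (complex^'N) set \<Rightarrow> complex^'N" where
  "affine_rep i L = (THE w. w \<in> L \<and> w $ i = 1)"

definition proj_atlas :: "((complex^'N::finite) set, 'n::finite) chart set" where
  "proj_atlas = {({L \<in> proj_space. \<exists>z\<in>L. z $ i \<noteq> 0}, \<lambda>L. \<chi> a. affine_rep i L $ \<sigma> a)
     | i (\<sigma> :: 'n \<Rightarrow> 'N). bij_betw \<sigma> UNIV (UNIV - {i})}"

definition homogeneous_poly :: "nat \<Rightarrow> (complex^'N::finite \<Rightarrow> complex) \<Rightarrow> bool" where
  "homogeneous_poly d F \<longleftrightarrow> (\<exists>c :: ('N \<Rightarrow> nat) \<Rightarrow> complex.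
     F = (\<lambda>z. \<Sum>\<alpha> | (\<Sum>i\<in>UNIV. \<alpha> i) = d. c \<alpha> * (\<Prod>i\<in>UNIV. z $ i ^ \<alpha> i)))"

definition partial :: "'N::finite \<Rightarrow> (complex^'N \<Rightarrow> complex) \<Rightarrow> complex^'N \<Rightarrow> complex" where
  "partial i F z = deriv (\<lambda>t. F (z + t *s axis i 1)) 0"

definition smooth_hypersurface :: "nat \<Rightarrow> (complex^'N::finite) set set \<Rightarrow> bool" where
  "smooth_hypersurface d X \<longleftrightarrow> (\<exists>F. homogeneous_poly d F \<and>
     (\<forall>z. z \<noteq> 0 \<and> F z = 0 \<longrightarrow> (\<exists>i. partial i F z \<noteq> 0)) \<and>
     X = {L \<in> proj_space. \<forall>z\<in>L. F z = 0})"

definition P4_atlas :: "((complex^5) set, 4) chart set" where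
  "P4_atlas = proj_atlas"

definition hypersurface_atlas :: "(complex^5) set set \<Rightarrow> ((complex^5) set, 3) chart set" where
  "hypersurface_atlas X = submanifold_atlas P4_atlas X"

end

theory Submission
  imports Defs "HOL-Complex_Analysis.Conformal_Mappings"
begin

text \<open>Let \<open>F\<close> be an equation of \<open>X\<close>, and describe 2-jets of curves
  in \<open>X\<close> by triples \<open>(x, p, q)\<close>, where \<open>x + t p + t^2/2 q\<close>
  is the beginning of a curve in the affine cone \<open>F = 0\<close>. This means \<open>F(x) =
  0\<close>, \<open>dF(p) = 0\<close> and \<open>d^2F(p, p) + dF(q) = 0\<close> at
  \<open>x\<close> (\<open>curve_in_zero_set\<close>, \<open>curve_with_jet\<close>). A section
  \<open>P\<close> is a function of such triples, polynomial in \<open>p\<close> and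
  \<open>q\<close>.

  Let \<open>b\<close> be the largest degree of \<open>P\<close> in the second derivatives that
  occurs anywhere. The coefficient \<open>B(x, p, q)\<close> of \<open>s^b\<close> in \<open>P(x,
  p, r + s q)\<close> is defined when \<open>p\<close> and \<open>q\<close> are both tangent to
  the cone at \<open>x\<close>, and it is independent of \<open>r\<close>. Fix the vectors
  \<open>p\<close> and \<open>q\<close> and let \<open>x\<close> vary. Then \<open>B\<close> is a
  function on the polar cone \<open>F = 0\<close>, \<open>dF(p) = 0\<close>, \<open>dF(q) =
  0\<close>. A constant vector represents a vector field on projective space with values twisted
  by \<open>O(-1)\<close>, so \<open>B\<close> is homogeneous in \<open>x\<close>, of degree
  \<open>-(m - 2 b) - b = -(m - b)\<close>, and this is negative because \<open>2 b \<le>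
  m\<close> and \<open>m \<ge> 1\<close>. The polar cone is given by three equations in a space of
  dimension five, so it defines a projective set of positive dimension everywhere, and a section
  of a negative line bundle on such a set is zero: otherwise a point where \<open>|B|\<close> is
  largest on the unit sphere would be a strict maximum of \<open>|B|\<close> on a hyperplane
  slice, in conflict with the maximum principle (\<open>leading_layer_on_polar_cone_zero\<close>).
  Since \<open>p\<close> and \<open>q\<close> were arbitrary tangent vectors, the part of degree
  \<open>b\<close> vanishes, contrary to the choice of \<open>b\<close>; so \<open>P = 0\<close>.

  The analytic core is the maximum principle \<open>no_strict_peak\<close> on possibly singular
  zero sets. It is proved by a perturbation to a zero set that is smooth at the relevant points,
  where the one-variable principle applies. The geometric input is \<open>affine_chart_ex\<close>,
  which produces charts of \<open>X\<close> in which \<open>P\<close> can be evaluated, together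
  with a holomorphic extension of the coefficients to a neighbourhood of \<open>X\<close> in the
  ambient space.\<close>

section \<open>Complex differentiability and polynomial functions\<close>

text \<open>The pointwise notion of complex differentiability behind \<open>holo_on\<close>.
  Working at a single point makes the closure rules below usable as introduction rules, with no
  domains to carry along.\<close>
definition cdiff :: "(complex^'n \<Rightarrow> complex) \<Rightarrow> complex^'n \<Rightarrow> bool" where
  "cdiff f z \<longleftrightarrow> (\<exists>D. (f has_derivative D) (at z) \<and> (\<forall>c v. D (c *s v) = c * D v))"

lemma holo_on_cdiff: "holo_on f S \<longleftrightarrow> (\<forall>z\<in>S. cdiff f z)"
  by (simp add: holo_on_def cdiff_def)

lemma cdiff_const [intro]: "cdiff (\<lambda>_. c) z"
  unfolding cdiff_def by (rule exI[of _ "\<lambda>_. 0"]) auto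

lemma cdiff_coord [intro]: "cdiff (\<lambda>z. z $ i) (z :: complex^'n::finite)"
  unfolding cdiff_def
  by (rule exI[of _ "\<lambda>v. v $ i"])
     (auto intro: bounded_linear_imp_has_derivative bounded_linear_vec_nth)

lemma cdiff_add [intro]: "cdiff f z \<Longrightarrow> cdiff g z \<Longrightarrow> cdiff (\<lambda>z. f z + g z) z"
  unfolding cdiff_def
  apply (elim exE conjE)
  subgoal for D E
    by (rule exI[of _ "\<lambda>v. D v + E v"]) (auto intro: has_derivative_add simp: algebra_simps)
  done

lemma cdiff_mult [intro]: "cdiff f z \<Longrightarrow> cdiff g z \<Longrightarrow> cdiff (\<lambda>z. f z * g z) z"
  unfolding cdiff_def
  apply (elim exE conjE)
  subgoal for D E
    using has_derivative_mult[of f D z UNIV g E]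
    by (intro exI[of _ "\<lambda>v. f z * E v + D v * g z"]) (simp add: distrib_left mult.left_commute)
  done

lemma cdiff_diff [intro]: "cdiff f z \<Longrightarrow> cdiff g z \<Longrightarrow> cdiff (\<lambda>z. f z - g z) z"
  using cdiff_add[of f z "\<lambda>z. (- 1) * g z"] cdiff_mult[of "\<lambda>_. - 1" z g] by auto

lemma cdiff_power [intro]: "cdiff f z \<Longrightarrow> cdiff (\<lambda>z. f z ^ n) z"
  by (induction n) auto

lemma cdiff_prod [intro]:
  "(\<And>i. i \<in> I \<Longrightarrow> cdiff (f i) z) \<Longrightarrow> cdiff (\<lambda>z. \<Prod>i\<in>I. f i z) z"
  by (induction I rule: infinite_finite_induct) auto

lemma cdiff_sum [intro]:
  "(\<And>i. i \<in> I \<Longrightarrow> cdiff (f i) z) \<Longrightarrow> cdiff (\<lambda>z. \<Sum>i\<in>I. f i z) z"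
  by (induction I rule: infinite_finite_induct) auto

lemma cdiff_inverse [intro]:
  assumes "cdiff f z" "f z \<noteq> 0"
  shows "cdiff (\<lambda>z. inverse (f z)) z"
proof -
  obtain D where D: "(f has_derivative D) (at z)" "\<And>c v. D (c *s v) = c * D v"
    using assms unfolding cdiff_def by blast
  have "((\<lambda>x. inverse (f x)) has_derivative (\<lambda>h. - (inverse (f z) * D h * inverse (f z)))) (at z)"
    by (rule Deriv.has_derivative_inverse) (use assms D in auto)
  then show ?thesis
    unfolding cdiff_def using D(2) by (intro exI conjI) auto
qed

lemma cdiff_divide [intro]:
  "cdiff f z \<Longrightarrow> cdiff g z \<Longrightarrow> g z \<noteq> 0 \<Longrightarrow> cdiff (\<lambda>z. f z / g z) z"
  unfolding divide_inverse by auto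

lemma cdiff_isCont: "cdiff f z \<Longrightarrow> isCont f z"
  unfolding cdiff_def using has_derivative_continuous by blast

lemma has_derivative_vec_components:
  fixes g :: "'a::real_normed_vector \<Rightarrow> complex^'m::finite"
  assumes "\<And>i. ((\<lambda>z. g z $ i) has_derivative (\<lambda>v. D v $ i)) (at z)"
  shows "(g has_derivative D) (at z)"
proof -
  have ax: "bounded_linear (axis i :: complex \<Rightarrow> complex^'m)" for i
    by (auto intro!: linearI simp: linear_conv_bounded_linear[symmetric] axis_def vec_eq_iff)
  have sum_axis: "x = (\<Sum>i\<in>UNIV. axis i (x $ i))" for x :: "complex^'m"
    by (auto simp: vec_eq_iff axis_def)
  have "((\<lambda>z. \<Sum>i\<in>UNIV. axis i (g z $ i)) has_derivative (\<lambda>v. \<Sum>i\<in>UNIV. axis i (D v $ i))) (at z)"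
    by (intro has_derivative_sum bounded_linear.has_derivative[OF ax] assms)
  then show ?thesis by (simp flip: sum_axis)
qed

lemma cdiff_compose:
  fixes g :: "complex^'n::finite \<Rightarrow> complex^'m::finite"
  assumes "\<And>i. cdiff (\<lambda>z. g z $ i) z" "cdiff f (g z)"
  shows "cdiff (\<lambda>z. f (g z)) z"
proof -
  obtain D where D: "\<And>i. ((\<lambda>z. g z $ i) has_derivative D i) (at z)"
      "\<And>i c v. D i (c *s v) = c * D i v"
    using assms(1) unfolding cdiff_def by metis
  obtain E where E: "(f has_derivative E) (at (g z))" "\<And>c v. E (c *s v) = c * E v"
    using assms(2) unfolding cdiff_def by blast
  have "(g has_derivative (\<lambda>v. \<chi> i. D i v)) (at z)"
    by (rule has_derivative_vec_components) (use D in auto)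
  then have "((\<lambda>z. f (g z)) has_derivative (\<lambda>v. E (\<chi> i. D i v))) (at z)"
    using E(1) by (rule has_derivative_compose)
  moreover have "E (\<chi> i. D i (c *s v)) = c * E (\<chi> i. D i v)" for c v
  proof -
    have "(\<chi> i. D i (c *s v)) = c *s (\<chi> i. D i v)"
      by (simp add: D(2) vec_eq_iff)
    then show ?thesis by (simp add: E(2))
  qed
  ultimately show ?thesis unfolding cdiff_def by (intro exI conjI) auto
qed

lemma cdiff_transform:
  assumes "cdiff f z" "open S" "z \<in> S" "\<And>y. y \<in> S \<Longrightarrow> f y = g y"
  shows "cdiff g z"
  using assms unfolding cdiff_def by (meson has_derivative_transform_within_open)

lemma cdiff_curve:
  fixes g :: "complex \<Rightarrow> complex^'n::finite"
  assumes "\<And>i. (\<lambda>t. g t $ i) field_differentiable at t" "cdiff f (g t)"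
  shows "(\<lambda>t. f (g t)) field_differentiable at t"
proof -
  obtain d where d: "\<And>i. ((\<lambda>t. g t $ i) has_field_derivative d i) (at t)"
    using assms(1) unfolding field_differentiable_def by metis
  obtain E where E: "(f has_derivative E) (at (g t))" "\<And>c v. E (c *s v) = c * E v"
    using assms(2) unfolding cdiff_def by blast
  have "(g has_derivative (\<lambda>v. \<chi> i. d i * v)) (at t)"
    by (rule has_derivative_vec_components) (use d in \<open>auto simp: has_field_derivative_def\<close>)
  then have "((\<lambda>z. f (g z)) has_derivative (\<lambda>v. E (\<chi> i. d i * v))) (at t)"
    using E(1) by (rule has_derivative_compose)
  moreover have "(\<lambda>v. E (\<chi> i. d i * v)) = (*) (E (\<chi> i. d i))"
  proof
    fix v
    have "(\<chi> i. d i * v) = v *s (\<chi> i. d i)" by (simp add: vec_eq_iff)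
    then show "E (\<chi> i. d i * v) = E (\<chi> i. d i) * v" by (simp add: E(2))
  qed
  ultimately show ?thesis
    unfolding field_differentiable_def has_field_derivative_def by metis
qed

text \<open>Polynomial functions in several complex variables. All the equations that occur below
  are of this kind, and the class is closed under partial derivatives; so the derivative of a map
  given by such functions, and its Jacobian determinant, are again polynomial, and continuity and
  holomorphy of derivatives never have to be deduced from the Cauchy formula.\<close>
inductive cpoly :: "(complex^'n \<Rightarrow> complex) \<Rightarrow> bool" where
  cpoly_const: "cpoly (\<lambda>_. c)"
| cpoly_coord: "cpoly (\<lambda>z. z $ i)"
| cpoly_add: "cpoly f \<Longrightarrow> cpoly g \<Longrightarrow> cpoly (\<lambda>z. f z + g z)"
| cpoly_mult: "cpoly f \<Longrightarrow> cpoly g \<Longrightarrow> cpoly (\<lambda>z. f z * g z)"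

lemmas [intro] = cpoly.intros

lemma cpoly_sum [intro]:
  "(\<And>i. i \<in> I \<Longrightarrow> cpoly (f i)) \<Longrightarrow> cpoly (\<lambda>z. \<Sum>i\<in>I. f i z)"
  by (induction I rule: infinite_finite_induct) auto

lemma cpoly_prod [intro]:
  "(\<And>i. i \<in> I \<Longrightarrow> cpoly (f i)) \<Longrightarrow> cpoly (\<lambda>z. \<Prod>i\<in>I. f i z)"
  by (induction I rule: infinite_finite_induct) auto

lemma cpoly_power [intro]: "cpoly f \<Longrightarrow> cpoly (\<lambda>z. f z ^ n)"
  by (induction n) auto

lemma cpoly_diff [intro]: "cpoly f \<Longrightarrow> cpoly g \<Longrightarrow> cpoly (\<lambda>z. f z - g z)"
  using cpoly_add[of f "\<lambda>z. (- 1) * g z"] cpoly_mult[of "\<lambda>_. - 1" g] by auto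

lemma cpoly_compose:
  assumes "cpoly f" "\<And>i. cpoly (\<lambda>z. g z $ i)"
  shows "cpoly (\<lambda>z. f (g z))"
  using assms(1) by induction (use assms(2) in auto)

lemma cpoly_cdiff: "cpoly f \<Longrightarrow> cdiff f z"
  for f :: "complex^'n::finite \<Rightarrow> complex"
  by (induction rule: cpoly.induct) auto

lemma cpoly_continuous [continuous_intros]: "cpoly f \<Longrightarrow> continuous_on S f"
  for f :: "complex^'n::finite \<Rightarrow> complex"
  by (simp add: continuous_at_imp_continuous_on cdiff_isCont cpoly_cdiff)

lemma cpoly_has_derivative_ex:
  fixes f :: "complex^'n::finite \<Rightarrow> complex"
  assumes "cpoly f"
  shows "\<exists>f'. (\<forall>i. cpoly (f' i)) \<and>
    (\<forall>z. (f has_derivative (\<lambda>v. \<Sum>i\<in>UNIV. f' i z * v $ i)) (at z))"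
  using assms
proof induction
  case (cpoly_const c)
  show ?case by (rule exI[of _ "\<lambda>_ _. 0"]) auto
next
  case (cpoly_coord j)
  show ?case
    by (rule exI[of _ "\<lambda>i _. if i = j then 1 else 0"])
       (auto simp: if_distrib[of "\<lambda>x. x * _"] cong: if_cong
         intro: bounded_linear_imp_has_derivative bounded_linear_vec_nth)
next
  case (cpoly_add f g)
  then obtain f' g' where *: "\<And>i. cpoly (f' i)" "\<And>i. cpoly (g' i)"
    "\<And>z. (f has_derivative (\<lambda>v. \<Sum>i\<in>UNIV. f' i z * v $ i)) (at z)"
    "\<And>z. (g has_derivative (\<lambda>v. \<Sum>i\<in>UNIV. g' i z * v $ i)) (at z)" by blast
  have "((\<lambda>z. f z + g z) has_derivative (\<lambda>v. \<Sum>i\<in>UNIV. (f' i z + g' i z) * v $ i)) (at z)" for z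
    using has_derivative_add[OF *(3)[of z] *(4)[of z]]
    by (simp add: algebra_simps sum.distrib)
  then show ?case using * by (intro exI[of _ "\<lambda>i z. f' i z + g' i z"]) auto
next
  case (cpoly_mult f g)
  then obtain f' g' where *: "\<And>i. cpoly (f' i)" "\<And>i. cpoly (g' i)"
    "\<And>z. (f has_derivative (\<lambda>v. \<Sum>i\<in>UNIV. f' i z * v $ i)) (at z)"
    "\<And>z. (g has_derivative (\<lambda>v. \<Sum>i\<in>UNIV. g' i z * v $ i)) (at z)" by blast
  have "((\<lambda>z. f z * g z) has_derivative
      (\<lambda>v. \<Sum>i\<in>UNIV. (f z * g' i z + f' i z * g z) * v $ i)) (at z)" for z
    using has_derivative_mult[OF *(3)[of z] *(4)[of z]]
    by (simp add: algebra_simps sum.distrib sum_distrib_left)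
  moreover have "cpoly (\<lambda>z. f z * g' i z + f' i z * g z)" for i
    by (intro cpoly.cpoly_add cpoly.cpoly_mult * cpoly_mult.hyps)
  ultimately show ?case by (intro exI[of _ "\<lambda>i z. f z * g' i z + f' i z * g z"]) blast
qed

lemma partial_eq:
  fixes f :: "complex^'n::finite \<Rightarrow> complex"
  assumes "(f has_derivative (\<lambda>v. \<Sum>i\<in>UNIV. c i * v $ i)) (at z)"
  shows "partial j f z = c j"
proof -
  have 1: "((\<lambda>t. z + t *s axis j 1) has_derivative (\<lambda>h. h *s axis j 1)) (at (0::complex))"
    by (rule has_derivative_vec_components)
       (auto intro!: derivative_eq_intros simp: axis_def)
  have "((\<lambda>t. f (z + t *s axis j 1)) has_derivative (\<lambda>h. \<Sum>i\<in>UNIV. c i * (h *s axis j 1) $ i)) (at 0)"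
    by (rule has_derivative_compose[OF 1]) (use assms in simp)
  moreover have "(\<lambda>h. \<Sum>i\<in>UNIV. c i * (h *s axis j 1) $ i) = (*) (c j)"
    by (auto simp: axis_def if_distrib[of "\<lambda>x. _ * x"] cong: if_cong)
  ultimately show ?thesis
    unfolding partial_def by (intro DERIV_imp_deriv) (simp add: has_field_derivative_def)
qed

lemma cpoly_partial:
  fixes f :: "complex^'n::finite \<Rightarrow> complex"
  assumes "cpoly f"
  shows "cpoly (partial j f)"
    and "(f has_derivative (\<lambda>v. \<Sum>i\<in>UNIV. partial i f z * v $ i)) (at z)"
proof -
  obtain f' where *: "\<And>i. cpoly (f' i)"
    "\<And>z. (f has_derivative (\<lambda>v. \<Sum>i\<in>UNIV. f' i z * v $ i)) (at z)"
    using cpoly_has_derivative_ex[OF assms] by blast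
  have "partial i f = f' i" for i
    using partial_eq[OF *(2)] by blast
  then show "cpoly (partial j f)" "(f has_derivative (\<lambda>v. \<Sum>i\<in>UNIV. partial i f z * v $ i)) (at z)"
    using * by auto
qed

lemma cpoly_curve_derivative:
  fixes g :: "complex \<Rightarrow> complex^'n::finite"
  assumes "cpoly f" "\<And>i. ((\<lambda>t. g t $ i) has_field_derivative d i) (at t)"
  shows "((\<lambda>t. f (g t)) has_field_derivative (\<Sum>i\<in>UNIV. partial i f (g t) * d i)) (at t)"
proof -
  have "(g has_derivative (\<lambda>v. \<chi> i. d i * v)) (at t)"
    by (rule has_derivative_vec_components)
       (use assms in \<open>auto simp: has_field_derivative_def\<close>)
  from has_derivative_compose[OF this cpoly_partial(2)[OF assms(1)]]
  show ?thesis
    unfolding has_field_derivative_def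
    by (rule has_derivative_eq_rhs) (simp add: fun_eq_iff sum_distrib_right mult.assoc)
qed

section \<open>Holomorphic inverse functions\<close>

lemma bounded_linear_matrix_vector:
  fixes A :: "complex^'n::finite^'m::finite"
  shows "bounded_linear (\<lambda>v. A *v v)"
  by (auto intro!: linearI simp: linear_conv_bounded_linear[symmetric] matrix_vector_right_distrib
        matrix_vector_mult_def vec_eq_iff scaleR_sum_right algebra_simps sum.distrib)

text \<open>The real inverse function theorem gives a differentiable local inverse. Its derivative
  is the inverse of a complex linear bijection, hence complex linear, so the inverse is
  holomorphic.\<close>
lemma cpoly_local_inverse:
  fixes \<Psi> :: "complex^'n::finite \<Rightarrow> complex^'n"
  assumes poly: "\<And>i. cpoly (\<lambda>z. \<Psi> z $ i)"
    and nz: "det (\<chi> i j. partial j (\<lambda>z. \<Psi> z $ i) z0) \<noteq> 0"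
  obtains W V g where "open W" "z0 \<in> W" "open V" "homeomorphism W V \<Psi> g" "holo_map_on g V"
proof -
  define J where "J = (\<lambda>z. \<chi> i j. partial j (\<lambda>z. \<Psi> z $ i) z)"
  have der: "(\<Psi> has_derivative (\<lambda>v. J z *v v)) (at z)" for z
    by (rule has_derivative_vec_components)
       (use cpoly_partial(2)[OF poly] in \<open>simp add: J_def matrix_vector_mult_def\<close>)
  obtain B where B: "B ** J z0 = mat 1"
    using nz invertible_det_nz[of "J z0"] by (auto simp: J_def invertible_def)
  define f' where "f' = (\<lambda>z. Blinfun (\<lambda>v. J z *v v))"
  have f'_app: "blinfun_apply (f' z) = (\<lambda>v. J z *v v)" for z
    by (simp add: f'_def bounded_linear_Blinfun_apply bounded_linear_matrix_vector)
  have contf: "continuous_on UNIV f'"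
  proof (rule continuous_on_blinfun_componentwise)
    fix b :: "complex^'n"
    have "continuous_on UNIV (\<lambda>z. \<chi> i. \<Sum>j\<in>UNIV. partial j (\<lambda>z. \<Psi> z $ i) z * b $ j)"
      by (intro continuous_on_vec_lambda cpoly_continuous cpoly_sum cpoly_mult cpoly_const
          cpoly_partial(1) poly)
    then show "continuous_on UNIV (\<lambda>x. blinfun_apply (f' x) b)"
      by (simp add: f'_app J_def matrix_vector_mult_def)
  qed
  have inv: "Blinfun (\<lambda>v. B *v v) o\<^sub>L f' z0 = id_blinfun"
    by (rule blinfun_eqI)
       (simp add: f'_app bounded_linear_Blinfun_apply bounded_linear_matrix_vector
         matrix_vector_mul_assoc B)
  have derf: "(\<Psi> has_derivative blinfun_apply (f' z)) (at z)" if "z \<in> UNIV" for z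
    using der by (simp add: f'_app)
  show thesis
  proof (rule inverse_function_theorem[OF open_UNIV derf contf UNIV_I inv])
    fix W V g g'
    assume W: "open W" "z0 \<in> W" "open V" "homeomorphism W V \<Psi> g"
      and g: "\<And>y. y \<in> V \<Longrightarrow> (g has_derivative (g' y)) (at y)"
        "\<And>y. y \<in> V \<Longrightarrow> g' y = inv (blinfun_apply (f'(g y)))"
        "\<And>y. y \<in> V \<Longrightarrow> bij (blinfun_apply (f'(g y)))"
    have "cdiff (\<lambda>y. g y $ i) y" if y: "y \<in> V" for y i
    proof -
      have "((\<lambda>y. g y $ i) has_derivative (\<lambda>v. g' y v $ i)) (at y)"
        by (rule bounded_linear.has_derivative[OF bounded_linear_vec_nth g(1)[OF y]])
      moreover have "g' y (c *s v) = c *s g' y v" for c v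
      proof -
        let ?h = "\<lambda>v. J (g y) *v v"
        have b: "bij ?h" and gy: "g' y = inv ?h" using g(2,3)[OF y] by (simp_all add: f'_app)
        have hg: "?h (g' y w) = w" for w
          using b gy by (metis bij_inv_eq_iff)
        have "?h (g' y (c *s v)) = ?h (c *s g' y v)"
          by (simp only: hg vector_scalar_commute)
        then show ?thesis using b by (meson bij_is_inj injD)
      qed
      ultimately show ?thesis unfolding cdiff_def by (intro exI conjI) auto
    qed
    then have "holo_map_on g V" by (simp add: holo_map_on_def holo_on_cdiff)
    with W show thesis by (intro that[of W V g])
qed
qed

text \<open>The implicit function theorem for curves: near a point where the Jacobian of
  \<open>\<Psi>\<close> is invertible, the locus on which all components of \<open>\<Psi>\<close>
  but the \<open>k\<close>-th are constant is a holomorphic curve, parametrised by the increment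
  of the \<open>k\<close>-th component.\<close>
lemma cpoly_local_curve:
  fixes \<Psi> :: "complex^'n::finite \<Rightarrow> complex^'n"
  assumes poly: "\<And>i. cpoly (\<lambda>z. \<Psi> z $ i)"
    and nz: "det (\<chi> i j. partial j (\<lambda>z. \<Psi> z $ i) z0) \<noteq> 0"
  obtains \<sigma> \<delta> where "\<delta> > 0" "\<sigma> 0 = z0"
    "\<And>t i. norm t < \<delta> \<Longrightarrow> (\<lambda>t. \<sigma> t $ i) field_differentiable (at t)"
    "\<And>t. norm t < \<delta> \<Longrightarrow> \<Psi> (\<sigma> t) = \<Psi> z0 + t *s axis k 1"
proof -
  obtain W V g where W: "open W" "z0 \<in> W" "open V" "homeomorphism W V \<Psi> g" "holo_map_on g V"
    using cpoly_local_inverse[OF assms] by blast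
  define l where "l = (\<lambda>t. \<Psi> z0 + t *s axis k 1)"
  have l: "(\<lambda>t. l t $ i) field_differentiable (at t)" for i t
    unfolding l_def field_differentiable_def by (auto intro!: derivative_eq_intros)
  have "continuous_on UNIV (\<lambda>t. \<chi> i. l t $ i)"
    by (rule continuous_on_vec_lambda)
       (use l in \<open>auto intro!: continuous_at_imp_continuous_on field_differentiable_imp_continuous_at\<close>)
  then have "continuous_on UNIV l" by simp
  then have "open (l -` V)" using W(3) by (simp add: open_vimage)
  moreover have "l 0 = \<Psi> z0" by (simp add: l_def)
  moreover have "\<Psi> z0 \<in> V" using W(2,4) by (auto simp: homeomorphism_def)
  ultimately obtain \<delta> where \<delta>: "\<delta> > 0" "\<And>t. norm t < \<delta> \<Longrightarrow> l t \<in> V"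
    unfolding open_contains_ball by (metis mem_ball_0 subsetD vimage_eq)
  show ?thesis
  proof (rule that[of \<delta> "\<lambda>t. g (l t)"])
    show "g (l 0) = z0" using W(2,4) \<open>l 0 = \<Psi> z0\<close> by (auto simp: homeomorphism_def)
    show "(\<lambda>t. g (l t) $ i) field_differentiable at t" if "norm t < \<delta>" for t i
      using cdiff_curve[of l t "\<lambda>y. g y $ i"] l W(5) \<delta>(2)[OF that]
      by (auto simp: holo_map_on_def holo_on_cdiff)
    show "\<Psi> (g (l t)) = \<Psi> z0 + t *s axis k 1" if "norm t < \<delta>" for t
      using W(4) \<delta>(2)[OF that] by (auto simp: homeomorphism_def l_def)
  qed (use \<delta> in auto)
qed

text \<open>The matrix \<open>1 + t A\<close> has a determinant that is a polynomial in
  \<open>t\<close> with value \<open>1\<close> at \<open>t = 0\<close>. It has finitely many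
  zeros, so large \<open>t = 1 / e\<close> avoid them.\<close>
lemma small_shift_invertible:
  fixes A :: "complex^'n::finite^'n"
  assumes "\<epsilon> > 0"
  obtains e where "e \<noteq> 0" "norm e < \<epsilon>" "det (\<chi> i j. A $ i $ j + e * (if i = j then 1 else 0)) \<noteq> 0"
proof -
  define p where "p = det (\<chi> i j. [: if i = j then 1 else 0, A $ i $ j :])"
  have p: "poly p t = det (\<chi> i j. (if i = j then 1 else 0) + t * A $ i $ j)" for t
    by (simp add: p_def det_def poly_sum poly_prod)
  have "poly p 0 = det (mat 1 :: complex^'n^'n)"
    unfolding p by (simp add: mat_def)
  then have "p \<noteq> 0" by auto
  then have "finite {t. poly p t = 0}" by (rule poly_roots_finite)
  then have "finite {n. poly p (of_nat n) = 0}"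
    using finite_vimageI[of "{t. poly p t = 0}" "of_nat :: nat \<Rightarrow> complex"]
    by (simp add: inj_of_nat vimage_def)
  then have "finite ({n. poly p (of_nat n) = 0} \<union> {..nat \<lceil>1/\<epsilon>\<rceil>})" by simp
  then obtain n where n: "n \<notin> {n. poly p (of_nat n) = 0} \<union> {..nat \<lceil>1/\<epsilon>\<rceil>}"
    by (metis ex_new_if_finite infinite_UNIV_nat)
  then have "real n > 1 / \<epsilon>" by (auto simp: not_le) linarith
  moreover have "1 / \<epsilon> > 0" using assms by simp
  ultimately have n0: "real n > 0" by linarith
  have ne: "1 / real n < \<epsilon>"
    using \<open>real n > 1 / \<epsilon>\<close> n0 assms by (simp add: field_simps)
  define e where "e = 1 / (of_nat n :: complex)"
  have "det (\<chi> i j. A $ i $ j + e * (if i = j then 1 else 0))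
      = det (\<chi> i. e *s (\<chi> j. (if i = j then 1 else 0) + of_nat n * A $ i $ j))"
    using n0 by (intro arg_cong[of _ _ det]) (auto simp: vec_eq_iff e_def field_simps)
  also have "\<dots> = (\<Prod>i\<in>(UNIV::'n set). e) * det (\<chi> i j. (if i = j then 1 else 0) + of_nat n * A $ i $ j)"
    by (rule det_rows_mul)
  also have "\<dots> \<noteq> 0" using n n0 by (simp add: e_def p)
  finally show ?thesis
    using n0 ne by (intro that[of e]) (auto simp: e_def norm_divide)
qed

section \<open>A maximum principle on zero sets\<close>

text \<open>The zero set of \<open>n - 1\<close> functions in \<open>n\<close> variables has no
  isolated points, and a holomorphic function cannot have a strict maximum of its modulus on it.
  The zero set may be singular or non-reduced, so it is replaced by a nearby one: the equations
  \<open>f i\<close> are perturbed to \<open>f i + e (z - x0)\<close>, which still vanish at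
  \<open>x0\<close> and, for suitable small \<open>e\<close>, have independent differentials
  there. The perturbed zero set may be singular elsewhere. This is harmless: let \<open>M\<close>
  be the Jacobian determinant and consider \<open>b ^ N * M\<close>. It is nonzero at
  \<open>x0\<close> and, for large \<open>N\<close>, smaller in modulus on the boundary of a small
  ball than at \<open>x0\<close>; so its maximum is attained in the interior, and automatically at
  a point where \<open>M\<close> does not vanish, that is, where the perturbed zero set is a
  smooth curve. By the one-variable maximum principle the function is constant along that curve.
  Among all maximisers choose one whose \<open>k\<close>-th coordinate has the largest real part;
  as the \<open>k\<close>-th coordinate is a parameter on the curve, moving along the curve
  contradicts this choice.\<close>
lemma no_strict_peak:
  fixes f :: "'n::finite \<Rightarrow> complex^'n \<Rightarrow> complex"
  assumes poly: "\<And>i. cpoly (f i)"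
    and zero: "\<And>i. i \<noteq> k \<Longrightarrow> f i x0 = 0"
    and G: "open G" "x0 \<in> G"
    and b: "\<And>z. z \<in> G \<Longrightarrow> cdiff b z" "b x0 \<noteq> 0"
    and peak: "\<And>z. \<lbrakk>z \<in> G; z \<noteq> x0; \<And>i. i \<noteq> k \<Longrightarrow> f i z = 0\<rbrakk> \<Longrightarrow> norm (b z) < norm (b x0)"
  shows False
proof -
  \<comment> \<open>With the zero function in place \<open>k\<close>, the perturbation is \<open>f0 + e * (id - x0)\<close>, whose Jacobian
      at \<open>x0\<close> is a matrix shifted by \<open>e\<close>; its \<open>k\<close>-th component is \<open>e\<close> times a coordinate.\<close>
  define f0 where "f0 = (\<lambda>i z. if i = k then 0 else f i z)"
  have f0_poly: "cpoly (f0 i)" for i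
    using poly by (cases "i = k") (auto simp: f0_def)
  obtain r where r: "r > 0" "cball x0 r \<subseteq> G"
    using G open_contains_cball by blast
  have bcont: "continuous_on (cball x0 r) b"
    using b(1) r(2) cdiff_isCont by (blast intro: continuous_at_imp_continuous_on)
  define \<Psi> where "\<Psi> = (\<lambda>e z. \<chi> i. f0 i z + e * (z $ i - x0 $ i))"
  have \<Psi>_poly: "cpoly (\<lambda>z. \<Psi> e z $ i)" for e i
    unfolding \<Psi>_def by (simp, intro cpoly.cpoly_add f0_poly cpoly.cpoly_mult cpoly_diff cpoly.cpoly_const cpoly.cpoly_coord)
  define M where "M = (\<lambda>e z. det (\<chi> i j. partial j (\<lambda>z. \<Psi> e z $ i) z))"
  have M_poly: "cpoly (M e)" for e
    unfolding M_def det_def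
    by (simp, intro cpoly_sum cpoly.cpoly_mult cpoly.cpoly_const cpoly_prod cpoly_partial \<Psi>_poly)
  define V where "V = (\<lambda>e. {z \<in> cball x0 r. \<forall>i. i \<noteq> k \<longrightarrow> \<Psi> e z $ i = 0})"
  have V_compact: "compact (V e)" for e
  proof -
    have "closed {z. \<Psi> e z $ i = 0}" for i
      by (rule closed_Collect_eq[OF cpoly_continuous[OF \<Psi>_poly] continuous_on_const])
    then have "closed (\<Inter>i\<in>-{k}. {z. \<Psi> e z $ i = 0})" by blast
    moreover have "(\<Inter>i\<in>-{k}. {z. \<Psi> e z $ i = 0}) = {z. \<forall>i. i \<noteq> k \<longrightarrow> \<Psi> e z $ i = 0}" by blast
    ultimately have "closed {z. \<forall>i. i \<noteq> k \<longrightarrow> \<Psi> e z $ i = 0}" by simp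
    then have "compact (cball x0 r \<inter> {z. \<forall>i. i \<noteq> k \<longrightarrow> \<Psi> e z $ i = 0})"
      by (intro compact_Int_closed) auto
    moreover have "cball x0 r \<inter> {z. \<forall>i. i \<noteq> k \<longrightarrow> \<Psi> e z $ i = 0} = V e"
      unfolding V_def by blast
    ultimately show ?thesis by simp
  qed
  have x0_V: "x0 \<in> V e" for e
    using r zero by (auto simp: V_def \<Psi>_def f0_def)
  \<comment> \<open>On the sphere a point of the perturbed zero set almost solves the original equations, and there
      the modulus of \<open>b\<close> stays away from its value at \<open>x0\<close> by compactness.\<close>
  have "\<exists>\<eta>>0. \<forall>e z. norm e < \<eta> \<longrightarrow> z \<in> V e \<longrightarrow> dist x0 z = r \<longrightarrow> norm (b z) \<le> norm (b x0) - \<eta>"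
  proof (cases "sphere x0 r = {}")
    case True
    then have "dist x0 z \<noteq> r" for z by (auto simp: sphere_def)
    then show ?thesis by (intro exI[of _ 1]) auto
  next
    case False
    define q where "q = (\<lambda>z. max (norm (b x0) - norm (b z)) (\<Sum>i\<in>UNIV. norm (f0 i z)))"
    have "continuous_on (sphere x0 r) q"
      unfolding q_def
      by (intro continuous_intros cpoly_continuous f0_poly continuous_on_subset[OF bcont]) auto
    then obtain z0 where z0: "z0 \<in> sphere x0 r" "\<And>z. z \<in> sphere x0 r \<Longrightarrow> q z0 \<le> q z"
      using continuous_attains_inf[of "sphere x0 r" q] False by auto
    have q0: "q z0 > 0"
    proof (cases "\<forall>i. f0 i z0 = 0")
      case True
      have "norm (b z0) < norm (b x0)"
      proof (rule peak)
        show "f i z0 = 0" if "i \<noteq> k" for i using True that by (metis f0_def)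
      qed (use z0 r in auto)
      then show ?thesis by (simp add: q_def less_max_iff_disj)
    next
      case False
      then obtain i where "f0 i z0 \<noteq> 0" by blast
      then have "0 < norm (f0 i z0)" by simp
      also have "\<dots> \<le> (\<Sum>i\<in>UNIV. norm (f0 i z0))" by (rule member_le_sum) auto
      finally show ?thesis by (simp add: q_def less_max_iff_disj)
    qed
    define c where "c = 1 + real CARD('n) * r"
    have c: "c \<ge> 1" using r by (simp add: c_def)
    define \<eta> where "\<eta> = q z0 / c"
    have \<eta>: "\<eta> > 0" "\<eta> \<le> q z0" using q0 c by (auto simp: \<eta>_def divide_le_eq_1 pos_divide_le_eq mult_le_cancel_left1)
    show ?thesis
    proof (intro exI[of _ \<eta>] conjI allI impI)
      fix e z assume e: "norm (e::complex) < \<eta>" and z: "z \<in> V e" "dist x0 z = r"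
      have "norm (f0 i z) \<le> norm e * r" for i
      proof (cases "i = k")
        case False
        with z have "f0 i z = - (e * (z $ i - x0 $ i))"
          by (auto simp: V_def \<Psi>_def add_eq_0_iff2)
        then have "norm (f0 i z) = norm e * norm ((z - x0) $ i)" by (simp add: norm_mult)
        also have "\<dots> \<le> norm e * r"
          using z(2) Finite_Cartesian_Product.norm_nth_le[of "z - x0" i]
          by (intro mult_left_mono) (auto simp: dist_norm norm_minus_commute)
        finally show ?thesis .
      qed (use r in \<open>auto simp: f0_def\<close>)
      then have "(\<Sum>i\<in>UNIV. norm (f0 i z)) \<le> (\<Sum>i\<in>(UNIV::'n set). norm e * r)"
        by (intro sum_mono) auto
      also have "\<dots> = norm e * (real CARD('n) * r)" by simp
      also have "\<dots> \<le> norm e * c" by (intro mult_left_mono) (auto simp: c_def)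
      also have "\<dots> < \<eta> * c" using e c by (intro mult_strict_right_mono) auto
      also have "\<dots> = q z0" using c by (simp add: \<eta>_def)
      finally have "(\<Sum>i\<in>UNIV. norm (f0 i z)) < q z0" .
      with z0(2)[of z] z(2) have "q z0 \<le> norm (b x0) - norm (b z)"
        by (auto simp: q_def sphere_def le_max_iff_disj)
      then show "norm (b z) \<le> norm (b x0) - \<eta>" using \<eta>(2) by linarith
    qed (use \<eta> in auto)
  qed
  then obtain \<eta> where \<eta>: "\<eta> > 0"
    "\<And>e z. \<lbrakk>norm e < \<eta>; z \<in> V e; dist x0 z = r\<rbrakk> \<Longrightarrow> norm (b z) \<le> norm (b x0) - \<eta>" by blast
  obtain e where e: "e \<noteq> 0" "norm e < \<eta>"
    "det (\<chi> i j. (\<chi> i j. partial j (f0 i) x0) $ i $ j + e * (if i = j then 1 else 0)) \<noteq> 0"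
    using small_shift_invertible[OF \<eta>(1)] by blast
  have "partial j (\<lambda>z. \<Psi> e z $ i) x0 = partial j (f0 i) x0 + e * (if i = j then 1 else 0)" for i j
  proof (rule partial_eq)
    have "((\<lambda>z. f0 i z + e * (z $ i - x0 $ i)) has_derivative
       (\<lambda>v. (\<Sum>j\<in>UNIV. partial j (f0 i) x0 * v $ j) + e * v $ i)) (at x0)"
      by (rule derivative_eq_intros cpoly_partial(2)[OF f0_poly]
          bounded_linear_imp_has_derivative[OF bounded_linear_vec_nth] refl | simp)+
    moreover have "(\<Sum>j\<in>UNIV. partial j (f0 i) x0 * v $ j) + e * v $ i =
      (\<Sum>j\<in>UNIV. (partial j (f0 i) x0 + e * (if i = j then 1 else 0)) * v $ j)" for v
      by (simp add: algebra_simps sum.distrib if_distrib[of "\<lambda>x. _ * x"] cong: if_cong)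
    ultimately show "((\<lambda>z. \<Psi> e z $ i) has_derivative
       (\<lambda>v. \<Sum>j\<in>UNIV. (partial j (f0 i) x0 + e * (if i = j then 1 else 0)) * v $ j)) (at x0)"
      by (simp add: \<Psi>_def)
  qed
  then have Mx0: "M e x0 \<noteq> 0" using e(3) by (simp add: M_def)
  have "compact (M e ` cball x0 r)"
    by (intro compact_continuous_image cpoly_continuous M_poly) auto
  then obtain C where C: "C > 0" "\<And>z. z \<in> cball x0 r \<Longrightarrow> norm (M e z) \<le> C"
    by (metis bounded_pos compact_imp_bounded image_eqI)
  define \<beta> where "\<beta> = max 0 (norm (b x0) - \<eta>)"
  have \<beta>: "0 \<le> \<beta>" "\<beta> < norm (b x0)" using b(2) \<eta>(1) by (auto simp: \<beta>_def)
  have "(\<lambda>N. (\<beta> / norm (b x0)) ^ N) \<longlonglongrightarrow> 0"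
    by (rule LIMSEQ_realpow_zero) (use \<beta> b(2) in auto)
  then have "\<forall>\<^sub>F N in sequentially. (\<beta> / norm (b x0)) ^ N < norm (M e x0) / C"
    by (rule order_tendstoD) (use C Mx0 in auto)
  then obtain N where "(\<beta> / norm (b x0)) ^ N < norm (M e x0) / C"
    by (auto simp: eventually_sequentially)
  then have N: "\<beta> ^ N * C < norm (b x0) ^ N * norm (M e x0)"
    using C(1) b(2) by (simp add: power_divide field_simps)
  define h where "h = (\<lambda>z. b z ^ N * M e z)"
  have h_cont: "continuous_on (V e) (\<lambda>z. norm (h z))"
    unfolding h_def
    by (intro continuous_intros cpoly_continuous M_poly continuous_on_subset[OF bcont]) (auto simp: V_def)
  obtain zm where zm: "zm \<in> V e" "\<And>z. z \<in> V e \<Longrightarrow> norm (h z) \<le> norm (h zm)"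
    using continuous_attains_sup[OF V_compact _ h_cont] x0_V by blast
  define X where "X = {z \<in> V e. norm (h z) = norm (h zm)}"
  have "compact X"
  proof -
    have "closed X" unfolding X_def
      by (rule continuous_closed_preimage_constant[OF h_cont])
         (use V_compact in \<open>auto intro: compact_imp_closed\<close>)
    then have "compact (V e \<inter> X)" using V_compact by blast
    moreover have "V e \<inter> X = X" by (auto simp: X_def)
    ultimately show ?thesis by simp
  qed
  moreover have "zm \<in> X" using zm by (simp add: X_def)
  moreover have "continuous_on X (\<lambda>z. Re (z $ k))" by (intro continuous_intros)
  ultimately obtain z1 where z1: "z1 \<in> X" "\<And>z. z \<in> X \<Longrightarrow> Re (z $ k) \<le> Re (z1 $ k)"
    using continuous_attains_sup[of X "\<lambda>z. Re (z $ k)"] by blast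
  have hz1: "norm (h z1) = norm (h zm)" "z1 \<in> V e" using z1 by (auto simp: X_def)
  have big: "\<beta> ^ N * C < norm (h z1)"
    using N zm(2)[OF x0_V] hz1 by (simp add: h_def norm_mult norm_power)
  have z1_ball: "z1 \<in> ball x0 r"
  proof (rule ccontr)
    assume "z1 \<notin> ball x0 r"
    then have d: "dist x0 z1 = r" using hz1(2) by (auto simp: V_def)
    have "norm (b z1) \<le> \<beta>" using \<eta>(2)[OF e(2) hz1(2) d] by (simp add: \<beta>_def)
    then have "norm (h z1) \<le> \<beta> ^ N * C"
      using C hz1(2) \<beta> by (auto simp: h_def norm_mult norm_power V_def intro!: mult_mono power_mono)
    with big show False by simp
  qed
  have "M e z1 \<noteq> 0"
    using big \<beta> C by (auto simp: h_def) (metis mult_nonneg_nonneg less_eq_real_def not_less zero_le_power)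
  then obtain \<sigma> \<delta> where \<sigma>: "\<delta> > 0" "\<sigma> 0 = z1"
    "\<And>t i. norm t < \<delta> \<Longrightarrow> (\<lambda>t. \<sigma> t $ i) field_differentiable (at t)"
    "\<And>t. norm t < \<delta> \<Longrightarrow> \<Psi> e (\<sigma> t) = \<Psi> e z1 + t *s axis k 1"
    using cpoly_local_curve[OF \<Psi>_poly, of e z1 k] unfolding M_def by metis
  have "continuous_on (ball 0 \<delta>) (\<lambda>t. \<chi> i. \<sigma> t $ i)"
    using \<sigma>(3) by (intro continuous_on_vec_lambda continuous_at_imp_continuous_on)
      (auto intro: field_differentiable_imp_continuous_at)
  then have \<sigma>_cont: "continuous_on (ball 0 \<delta>) \<sigma>" by simp
  have "open (ball 0 \<delta> \<inter> \<sigma> -` ball x0 r)"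
    by (rule continuous_open_preimage[OF \<sigma>_cont]) auto
  moreover have "0 \<in> ball 0 \<delta> \<inter> \<sigma> -` ball x0 r" using \<sigma> z1_ball by simp
  ultimately obtain \<rho> where \<rho>: "\<rho> > 0" "ball 0 \<rho> \<subseteq> ball 0 \<delta> \<inter> \<sigma> -` ball x0 r"
    by (meson open_contains_ball)
  have \<sigma>V: "\<sigma> t \<in> V e" and \<sigma>G: "\<sigma> t \<in> G" and t\<delta>: "norm t < \<delta>" if "t \<in> ball 0 \<rho>" for t
  proof -
    from \<rho>(2) that have t: "norm t < \<delta>" "\<sigma> t \<in> ball x0 r" by auto
    then have "\<Psi> e (\<sigma> t) $ i = 0" if "i \<noteq> k" for i
      using \<sigma>(4)[OF t(1)] hz1(2) that by (simp add: V_def axis_def)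
    then show "\<sigma> t \<in> V e" using t(2) by (simp add: V_def)
    show "\<sigma> t \<in> G" "norm t < \<delta>" using t r(2) by auto
  qed
  have "(\<lambda>t. h (\<sigma> t)) constant_on ball 0 \<rho>"
  proof (rule maximum_modulus_principle[of _ _ "ball 0 \<rho>" 0])
    have "(\<lambda>t. h (\<sigma> t)) field_differentiable at t" if "t \<in> ball 0 \<rho>" for t
    proof (rule cdiff_curve)
      show "cdiff h (\<sigma> t)"
        unfolding h_def by (intro cdiff_mult cdiff_power b(1) cpoly_cdiff M_poly \<sigma>G that)
    qed (rule \<sigma>(3)[OF t\<delta>[OF that]])
    then show "(\<lambda>t. h (\<sigma> t)) holomorphic_on ball 0 \<rho>"
      by (auto simp: holomorphic_on_def intro: field_differentiable_at_within)
    show "norm (h (\<sigma> t)) \<le> norm (h (\<sigma> 0))" if "t \<in> ball 0 \<rho>" for t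
      using zm(2)[OF \<sigma>V[OF that]] hz1 by (simp add: \<sigma>(2))
  qed (use \<rho> in auto)
  then have const: "h (\<sigma> t) = h z1" if "t \<in> ball 0 \<rho>" for t
    using that \<rho>(1) \<sigma>(2) unfolding constant_on_def by (metis centre_in_ball)
  \<comment> \<open>The parameter \<open>t = e * s\<close> shifts the \<open>k\<close>-th coordinate by the positive real number \<open>s\<close>.\<close>
  define s where "s = \<rho> / (2 * norm e)"
  define t where "t = e * of_real s"
  have s: "s > 0" using \<rho> e by (simp add: s_def)
  have "norm t = norm e * s" using s by (simp add: t_def norm_mult)
  then have t: "t \<in> ball 0 \<rho>" using \<rho>(1) e(1) by (simp add: s_def)
  have "\<sigma> t \<in> X" using \<sigma>V[OF t] const[OF t] hz1 by (simp add: X_def)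
  then have "Re (\<sigma> t $ k) \<le> Re (z1 $ k)" by (rule z1(2))
  moreover have "e * (\<sigma> t $ k) = e * (z1 $ k + of_real s)"
    using arg_cong[OF \<sigma>(4)[OF t\<delta>[OF t]], of "\<lambda>v. v $ k"]
    by (simp add: \<Psi>_def f0_def t_def axis_def algebra_simps)
  then have "\<sigma> t $ k = z1 $ k + of_real s" using e(1) by simp
  ultimately show False using s by simp
qed

section \<open>Curves with prescribed 2-jet in a zero set\<close>

definition differential :: "(complex^'n::finite \<Rightarrow> complex) \<Rightarrow> complex^'n \<Rightarrow> complex^'n \<Rightarrow> complex" where
  "differential f x v = (\<Sum>i\<in>UNIV. partial i f x * v $ i)"

definition hessian :: "(complex^'n::finite \<Rightarrow> complex) \<Rightarrow> complex^'n \<Rightarrow> complex^'n \<Rightarrow> complex" where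
  "hessian f x v = (\<Sum>i\<in>UNIV. (\<Sum>j\<in>UNIV. partial j (partial i f) x * v $ j) * v $ i)"

lemma differential_add: "differential f x (v + w) = differential f x v + differential f x w"
  by (simp add: differential_def algebra_simps sum.distrib)

lemma differential_scale: "differential f x (c *s v) = c * differential f x v"
  by (simp add: differential_def algebra_simps sum_distrib_left)

lemma differential_axis: "differential f x (axis i c) = partial i f x * c"
  by (simp add: differential_def axis_def if_distrib[of "\<lambda>x. _ * x"] cong: if_cong)

lemma cpoly_differential: "cpoly f \<Longrightarrow> cpoly (\<lambda>x. differential f x v)"
  unfolding differential_def by (intro cpoly_sum cpoly.cpoly_mult cpoly_partial(1) cpoly.cpoly_const)

definition has_jet :: "(complex \<Rightarrow> complex^'n) \<Rightarrow> complex^'n \<Rightarrow> complex^'n \<Rightarrow> complex^'n \<Rightarrow> bool" where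
  "has_jet c x p q \<longleftrightarrow> c 0 = x \<and> (\<forall>i. (\<lambda>t. c t $ i) analytic_on {0} \<and>
     deriv (\<lambda>t. c t $ i) 0 = p $ i \<and> deriv (deriv (\<lambda>t. c t $ i)) 0 = q $ i)"

text \<open>Differentiating \<open>f (c t) = 0\<close> once and twice gives the equations that a
  2-jet of a curve in the zero set of \<open>f\<close> satisfies.\<close>
lemma curve_in_zero_set:
  fixes c :: "complex \<Rightarrow> complex^'n::finite"
  assumes f: "cpoly f" and S: "open S" "0 \<in> S"
    and c1: "\<And>t i. t \<in> S \<Longrightarrow> ((\<lambda>t. c t $ i) has_field_derivative c1 t $ i) (at t)"
    and c2: "\<And>i. ((\<lambda>t. c1 t $ i) has_field_derivative c2 $ i) (at 0)"
    and zero: "\<And>t. t \<in> S \<Longrightarrow> f (c t) = 0"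
  shows "differential f (c 0) (c1 0) = 0"
    and "hessian f (c 0) (c1 0) + differential f (c 0) c2 = 0"
proof -
  have 1: "differential f (c t) (c1 t) = 0" if t: "t \<in> S" for t
  proof -
    have "((\<lambda>t. f (c t)) has_field_derivative differential f (c t) (c1 t)) (at t)"
      unfolding differential_def by (rule cpoly_curve_derivative[OF f c1[OF t]])
    moreover have "((\<lambda>t. f (c t)) has_field_derivative 0) (at t)"
      by (rule has_field_derivative_transform_within_open[OF DERIV_const S(1) t]) (simp add: zero)
    ultimately show ?thesis by (rule DERIV_unique)
  qed
  show "differential f (c 0) (c1 0) = 0" by (rule 1[OF S(2)])
  have "((\<lambda>t. differential f (c t) (c1 t)) has_field_derivative
      (\<Sum>i\<in>UNIV. (\<Sum>j\<in>UNIV. partial j (partial i f) (c 0) * c1 0 $ j) * c1 0 $ i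
         + c2 $ i * partial i f (c 0))) (at 0)"
    unfolding differential_def
    by (intro DERIV_sum DERIV_mult cpoly_curve_derivative cpoly_partial(1) f c1 S c2)
  moreover have "((\<lambda>t. differential f (c t) (c1 t)) has_field_derivative 0) (at 0)"
    by (rule has_field_derivative_transform_within_open[OF DERIV_const S]) (simp add: 1)
  ultimately have "(\<Sum>i\<in>UNIV. (\<Sum>j\<in>UNIV. partial j (partial i f) (c 0) * c1 0 $ j) * c1 0 $ i
         + c2 $ i * partial i f (c 0)) = 0"
    by (rule DERIV_unique)
  then show "hessian f (c 0) (c1 0) + differential f (c 0) c2 = 0"
    by (simp add: hessian_def differential_def sum.distrib mult.commute)
qed

lemma det_nz_if_inj:
  fixes A :: "complex^'n::finite^'n"
  assumes "\<And>v. A *v v = 0 \<Longrightarrow> v = 0"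
  shows "det A \<noteq> 0"
proof -
  have "inj ((*v) A)"
  proof (rule injI)
    fix v w assume "A *v v = A *v w"
    then have "A *v (v - w) = 0" by (simp add: matrix_vector_mult_diff_distrib)
    then show "v = w" using assms by fastforce
  qed
  then have "\<exists>B. B ** A = mat 1" by (simp add: matrix_left_invertible_injective)
  then show ?thesis by (metis invertible_det_nz invertible_left_inverse)
qed

text \<open>Conversely these two equations suffice. Correct the parabola \<open>x + t p + t^2/2
  q\<close> in a direction \<open>e\<^sub>j\<close> transverse to the zero set by a function
  \<open>s t\<close> from the implicit function theorem; the two equations, compared with those of
  the corrected curve, force \<open>s\<close> to vanish to third order.\<close>
lemma curve_with_jet:
  fixes f :: "complex^'n::finite \<Rightarrow> complex"
  assumes f: "cpoly f" "f x = 0" and j: "partial j f x \<noteq> 0"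
    and p: "differential f x p = 0" and q: "hessian f x p + differential f x q = 0"
  obtains c where "has_jet c x p q" "\<forall>\<^sub>F t in nhds 0. f (c t) = 0"
proof -
  define C where "C = (\<lambda>t s. x + t *s p + (t^2 / 2) *s q + s *s axis j 1)"
  define \<Psi> where "\<Psi> = (\<lambda>y::complex^2. \<chi> i::2. if i = 1 then y $ 1 else f (C (y $ 1) (y $ 2)))"
  have fC: "cpoly (\<lambda>y::complex^2. f (C (y $ 1) (y $ 2)))"
  proof (rule cpoly_compose[OF f(1)])
    have "cpoly (\<lambda>y::complex^2. x $ i + y $ 1 * p $ i + (1/2) * (y $ 1)^2 * q $ i + y $ 2 * axis j 1 $ i)" for i
      by (intro cpoly.intros cpoly_power)
    then show "cpoly (\<lambda>y::complex^2. C (y $ 1) (y $ 2) $ i)" for i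
      by (simp add: C_def)
  qed
  have poly: "cpoly (\<lambda>y. \<Psi> y $ i)" for i
    using fC cpoly.cpoly_coord[of 1] by (cases "i = 1") (simp_all add: \<Psi>_def)
  have "partial 2 (\<lambda>y::complex^2. f (C (y $ 1) (y $ 2))) 0 = partial j f x"
    by (simp add: partial_def C_def axis_def)
  moreover have "partial 1 (\<lambda>y::complex^2. y $ 1) 0 = 1" "partial 2 (\<lambda>y::complex^2. y $ 1) 0 = 0"
    by (simp_all add: partial_def axis_def)
  ultimately have "det (\<chi> i l. partial l (\<lambda>z. \<Psi> z $ i) 0) \<noteq> 0"
    using j by (simp add: det_2 \<Psi>_def)
  then obtain \<sigma> \<delta> where \<sigma>: "\<delta> > 0" "\<sigma> 0 = 0"
    "\<And>t i. norm t < \<delta> \<Longrightarrow> (\<lambda>t. \<sigma> t $ i) field_differentiable (at t)"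
    "\<And>t. norm t < \<delta> \<Longrightarrow> \<Psi> (\<sigma> t) = \<Psi> 0 + t *s axis 1 1"
    using cpoly_local_curve[OF poly, of 0 1] by metis
  define s where "s = (\<lambda>t. \<sigma> t $ 2)"
  define c where "c = (\<lambda>t. C t (s t))"
  have \<sigma>1: "\<sigma> t $ 1 = t" and fc: "f (c t) = 0" if "norm t < \<delta>" for t
  proof -
    have "\<Psi> (\<sigma> t) $ 1 = t" "\<Psi> (\<sigma> t) $ 2 = 0"
      unfolding \<sigma>(4)[OF that] by (simp_all add: \<Psi>_def C_def f(2) axis_def)
    then show "\<sigma> t $ 1 = t" "f (c t) = 0" by (simp_all add: \<Psi>_def c_def s_def)
  qed
  have s_hol: "s holomorphic_on ball 0 \<delta>"
    using \<sigma>(3) unfolding s_def holomorphic_on_def by (auto intro: field_differentiable_at_within)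
  have s1: "(s has_field_derivative deriv s t) (at t)" if "norm t < \<delta>" for t
    using \<sigma>(3)[OF that] by (simp add: s_def field_differentiable_derivI)
  have "deriv s holomorphic_on ball 0 \<delta>" by (rule holomorphic_deriv[OF s_hol]) simp
  then have s2: "(deriv s has_field_derivative deriv (deriv s) 0) (at 0)"
    using \<sigma>(1) by (auto intro: holomorphic_derivI)
  define c1 where "c1 = (\<lambda>t. p + t *s q + deriv s t *s axis j 1)"
  define c2 where "c2 = q + deriv (deriv s) 0 *s axis j 1"
  have D1: "((\<lambda>t. c t $ i) has_field_derivative c1 t $ i) (at t)" if "t \<in> ball 0 \<delta>" for t i
    unfolding c_def c1_def C_def using that
    by (auto intro!: derivative_eq_intros s1)
  have D2: "((\<lambda>t. c1 t $ i) has_field_derivative c2 $ i) (at 0)" for i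
    unfolding c1_def c2_def by (auto intro!: derivative_eq_intros s2)
  have c0: "c 0 = x" by (simp add: c_def C_def s_def \<sigma>(2))
  note zs = curve_in_zero_set[OF f(1) open_ball[of 0 \<delta>] _ D1 D2, unfolded c0]
  have s'0: "deriv s 0 = 0"
  proof -
    have "differential f x (c1 0) = 0" by (rule zs(1)) (use \<sigma> fc in auto)
    then show ?thesis using j p
      by (simp add: c1_def differential_add differential_scale differential_axis)
  qed
  have c10: "c1 0 = p" by (simp add: c1_def s'0)
  have "hessian f x (c1 0) + differential f x c2 = 0" by (rule zs(2)) (use \<sigma> fc in auto)
  then have s''0: "deriv (deriv s) 0 = 0" using q j
    by (simp add: c10 c2_def differential_add differential_scale differential_axis add.assoc[symmetric])
  then have c2: "c2 = q" by (simp add: c2_def)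
  have near: "\<forall>\<^sub>F t in nhds 0. t \<in> ball (0::complex) \<delta>"
    using \<sigma>(1) by (intro eventually_nhds_in_open) auto
  have "has_jet c x p q" unfolding has_jet_def
  proof (intro conjI allI)
    fix i
    have "(\<lambda>t. c t $ i) holomorphic_on ball 0 \<delta>"
      using D1 unfolding holomorphic_on_open[OF open_ball] by blast
    then show "(\<lambda>t. c t $ i) analytic_on {0}"
      unfolding analytic_at using \<sigma>(1) by (intro exI[of _ "ball 0 \<delta>"]) simp
    show "deriv (\<lambda>t. c t $ i) 0 = p $ i"
      using D1[of 0 i] \<sigma>(1) by (simp add: DERIV_imp_deriv c10)
    have "deriv (deriv (\<lambda>t. c t $ i)) 0 = deriv (\<lambda>t. c1 t $ i) 0"
      by (rule deriv_cong_ev[OF eventually_mono[OF near DERIV_imp_deriv[OF D1]]]) simp_all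
    then show "deriv (deriv (\<lambda>t. c t $ i)) 0 = q $ i"
      using D2[of i] by (simp add: DERIV_imp_deriv c2)
  qed (rule c0)
  moreover have "\<forall>\<^sub>F t in nhds 0. f (c t) = 0"
    using near by (rule eventually_mono) (auto intro: fc)
  ultimately show ?thesis by (rule that)
qed

lemma deriv_quotient:
  assumes f: "f analytic_on {0::complex}" and g: "g analytic_on {0}" "g 0 \<noteq> 0"
  defines "u \<equiv> (\<lambda>t. f t / g t)"
  shows "deriv u 0 = (deriv f 0 - f 0 / g 0 * deriv g 0) / g 0"
    and "deriv (deriv u) 0 = (deriv (deriv f) 0 - 2 * deriv u 0 * deriv g 0 - f 0 / g 0 * deriv (deriv g) 0) / g 0"
proof -
  obtain Sf where Sf: "open Sf" "0 \<in> Sf" "f holomorphic_on Sf" using f by (auto simp: analytic_at)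
  obtain Sg where Sg: "open Sg" "0 \<in> Sg" "g holomorphic_on Sg" using g by (auto simp: analytic_at)
  have "open (Sg \<inter> g -` (- {0}))"
    by (rule continuous_open_preimage) (use Sg holomorphic_on_imp_continuous_on in auto)
  define S where "S = Sf \<inter> (Sg \<inter> g -` (- {0}))"
  have S: "open S" "0 \<in> S" "f holomorphic_on S" "g holomorphic_on S" "\<And>t. t \<in> S \<Longrightarrow> g t \<noteq> 0"
    using Sf Sg g(2) \<open>open (Sg \<inter> g -` (- {0}))\<close>
    by (auto simp: S_def intro: holomorphic_on_subset)
  have u: "u holomorphic_on S" unfolding u_def using S by (intro holomorphic_intros) auto
  have du: "deriv u holomorphic_on S" "deriv g holomorphic_on S"
    using u S by (auto intro: holomorphic_deriv)
  have f1: "deriv f t = deriv u t * g t + u t * deriv g t" if t: "t \<in> S" for t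
  proof -
    have "((\<lambda>t. u t * g t) has_field_derivative deriv u t * g t + deriv g t * u t) (at t)"
      by (intro DERIV_mult holomorphic_derivI[OF u S(1) t] holomorphic_derivI[OF S(4) S(1) t])
    moreover have "u t * g t = f t" if "t \<in> S" for t using S(5)[OF that] by (simp add: u_def)
    ultimately have "(f has_field_derivative deriv u t * g t + deriv g t * u t) (at t)"
      using S(1) t by (blast intro: has_field_derivative_transform_within_open)
    then show ?thesis by (simp add: DERIV_imp_deriv mult.commute)
  qed
  have u0: "u 0 = f 0 / g 0" by (simp add: u_def)
  show 1: "deriv u 0 = (deriv f 0 - f 0 / g 0 * deriv g 0) / g 0"
    using f1[OF S(2)] g(2) by (simp add: u0[symmetric] field_simps)
  have "((\<lambda>t. deriv u t * g t + u t * deriv g t) has_field_derivative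
      (deriv (deriv u) 0 * g 0 + deriv g 0 * deriv u 0 + (deriv u 0 * deriv g 0 + deriv (deriv g) 0 * u 0))) (at 0)"
    by (intro DERIV_add DERIV_mult holomorphic_derivI[OF _ S(1,2)] u du S(4))
  then have "(deriv f has_field_derivative
      (deriv (deriv u) 0 * g 0 + deriv g 0 * deriv u 0 + (deriv u 0 * deriv g 0 + deriv (deriv g) 0 * u 0))) (at 0)"
    by (rule has_field_derivative_transform_within_open[OF _ S(1,2)]) (simp add: f1)
  then have "deriv (deriv f) 0 =
      deriv (deriv u) 0 * g 0 + 2 * deriv u 0 * deriv g 0 + u 0 * deriv (deriv g) 0"
    by (simp add: DERIV_imp_deriv algebra_simps)
  then show "deriv (deriv u) 0 = (deriv (deriv f) 0 - 2 * deriv u 0 * deriv g 0 - f 0 / g 0 * deriv (deriv g) 0) / g 0"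
    using g(2) by (simp add: u0[symmetric] field_simps)
qed

section \<open>Affine charts of projective space\<close>

text \<open>The point of projective space with homogeneous coordinates \<open>x\<close>.\<close>
definition pt :: "complex^'n \<Rightarrow> (complex^'n) set" where
  "pt x = range (\<lambda>c. c *s x)"

lemma pt_mem: "c *s x \<in> pt x" "x \<in> pt x"
proof -
  show "c *s x \<in> pt x" for c by (auto simp: pt_def)
  from this[of 1] show "x \<in> pt x" by simp
qed

lemma pt_scale:
  assumes "c \<noteq> 0"
  shows "pt (c *s x) = pt x"
proof (intro set_eqI iffI)
  fix y assume "y \<in> pt (c *s x)"
  then obtain d where "y = (d * c) *s x" by (auto simp: pt_def)
  then show "y \<in> pt x" using pt_mem(1) by metis
next
  fix y assume "y \<in> pt x"
  then obtain d where "y = d *s x" by (auto simp: pt_def)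
  then have "y = (d / c) *s (c *s x)" using assms by simp
  then show "y \<in> pt (c *s x)" using pt_mem(1) by metis
qed

lemma proj_space_iff: "L \<in> proj_space \<longleftrightarrow> (\<exists>x. x \<noteq> 0 \<and> L = pt (x :: complex^'n::finite))"
proof
  assume "L \<in> proj_space"
  then have L: "vec.subspace L" "vec.dim L = 1" by (auto simp: proj_space_def)
  obtain B where B: "B \<subseteq> L" "vec.independent B" "L \<subseteq> vec.span B" "card B = vec.dim L"
    by (rule vec.basis_exists)
  then obtain x where x: "B = {x}" using L(2) by (metis card_1_singletonE)
  have "vec.span B = L" using B(1,3) L(1) by (simp add: vec.span_subspace)
  then have "L = pt x" by (simp add: x vec.span_singleton pt_def)
  moreover have "x \<noteq> 0" using B(2) x by (metis vec.dependent_zero insertI1)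
  ultimately show "\<exists>x. x \<noteq> 0 \<and> L = pt x" by blast
next
  assume "\<exists>x. x \<noteq> 0 \<and> L = pt x"
  then obtain x where x: "x \<noteq> 0" "L = vec.span {x}" by (auto simp: pt_def vec.span_singleton)
  then show "L \<in> proj_space" by (simp add: proj_space_def)
qed

lemma affine_rep_pt:
  fixes x :: "complex^'n::finite"
  assumes "x $ i \<noteq> 0"
  shows "affine_rep i (pt x) = (1 / x $ i) *s x"
  unfolding affine_rep_def
proof (rule the_equality)
  show "(1 / x $ i) *s x \<in> pt x \<and> ((1 / x $ i) *s x) $ i = 1" using assms by (simp add: pt_mem)
  fix w assume "w \<in> pt x \<and> w $ i = 1"
  then obtain c where c: "w = c *s x" and "w $ i = 1" unfolding pt_def by blast
  then have "c = 1 / x $ i" using assms by (simp add: eq_divide_eq)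
  with c show "w = (1 / x $ i) *s x" by simp
qed

definition aff_dom :: "'N \<Rightarrow> (complex^'N) set set" where
  "aff_dom i = {L \<in> proj_space. \<exists>z\<in>L. z $ i \<noteq> 0}"

definition aff_coord :: "'N \<Rightarrow> ('n \<Rightarrow> 'N) \<Rightarrow> (complex^'N) set \<Rightarrow> complex^'n" where
  "aff_coord i \<sigma> L = (\<chi> a. affine_rep i L $ \<sigma> a)"

text \<open>The affine coordinates as functions of the homogeneous ones. The same formula with
  fewer indices gives the coordinates used later on the hypersurface.\<close>
definition ratios :: "'N \<Rightarrow> ('n \<Rightarrow> 'N) \<Rightarrow> complex^'N \<Rightarrow> complex^'n" where
  "ratios i \<sigma> x = (\<chi> a. x $ \<sigma> a / x $ i)"

text \<open>The section of \<open>ratios\<close> over the affine hyperplane \<open>x\<^sub>i =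
  1\<close>.\<close>
definition emb :: "'N \<Rightarrow> ('n \<Rightarrow> 'N) \<Rightarrow> complex^'n \<Rightarrow> complex^'N" where
  "emb i \<sigma> w = (\<chi> k. if k = i then 1 else w $ inv_into UNIV \<sigma> k)"

lemma pt_in_aff_dom: "x \<noteq> 0 \<Longrightarrow> pt x \<in> aff_dom i \<longleftrightarrow> x $ i \<noteq> 0" for x :: "complex^'n::finite"
  using pt_mem(2)[of x] by (auto simp: aff_dom_def proj_space_iff) (auto simp: pt_def)

lemma aff_dom_cases:
  fixes L :: "(complex^'n::finite) set"
  assumes "L \<in> aff_dom i"
  obtains x where "L = pt x" "x $ i \<noteq> 0" "x \<noteq> 0"
  using assms pt_in_aff_dom by (metis (no_types, lifting) aff_dom_def mem_Collect_eq proj_space_iff)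

lemma aff_coord_pt: "x $ i \<noteq> 0 \<Longrightarrow> aff_coord i \<sigma> (pt x) = ratios i \<sigma> x" for x :: "complex^'n::finite"
  by (simp add: aff_coord_def ratios_def affine_rep_pt vec_eq_iff)

context
  fixes i :: "'N::finite" and \<sigma> :: "'n::finite \<Rightarrow> 'N"
  assumes \<sigma>: "bij_betw \<sigma> UNIV (UNIV - {i})"
begin

lemma chart_index: "\<sigma> a \<noteq> i" "inv_into UNIV \<sigma> (\<sigma> a) = a" "k \<noteq> i \<Longrightarrow> \<sigma> (inv_into UNIV \<sigma> k) = k"
  "\<sigma> a = \<sigma> b \<longleftrightarrow> a = b"
proof -
  show "\<sigma> a \<noteq> i" using \<sigma> unfolding bij_betw_def by blast
  show "inv_into UNIV \<sigma> (\<sigma> a) = a" using \<sigma> unfolding bij_betw_def by simp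
  show "k \<noteq> i \<Longrightarrow> \<sigma> (inv_into UNIV \<sigma> k) = k" using \<sigma> unfolding bij_betw_def
    by (metis Diff_iff UNIV_I f_inv_into_f singletonD)
  show "\<sigma> a = \<sigma> b \<longleftrightarrow> a = b" using \<sigma> unfolding bij_betw_def by (auto dest: injD)
qed

lemma emb_nth: "emb i \<sigma> w $ i = 1" "emb i \<sigma> w $ \<sigma> a = w $ a"
  using chart_index by (simp_all add: emb_def)

lemma ratios_emb: "ratios i \<sigma> (emb i \<sigma> w) = w"
  by (simp add: ratios_def emb_nth vec_eq_iff)

lemma emb_ratios: "x $ i \<noteq> 0 \<Longrightarrow> emb i \<sigma> (ratios i \<sigma> x) = (1 / x $ i) *s x"
  using chart_index by (auto simp: emb_def ratios_def vec_eq_iff)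

lemma emb_add_axis: "emb i \<sigma> (w + t *s axis a 1) = emb i \<sigma> w + t *s axis (\<sigma> a) 1"
  using chart_index by (auto simp: emb_def vec_eq_iff axis_def)

lemma emb_nz: "emb i \<sigma> w \<noteq> 0"
  using emb_nth(1) by (metis zero_index zero_neq_one)

lemma cpoly_emb: "cpoly (\<lambda>w. emb i \<sigma> w $ k)"
  by (cases "k = i") (auto simp: emb_def)

lemma pt_emb: "pt (emb i \<sigma> w) \<in> aff_dom i" "aff_coord i \<sigma> (pt (emb i \<sigma> w)) = w"
  by (simp_all add: pt_in_aff_dom emb_nz emb_nth aff_coord_pt ratios_emb)

lemma pt_emb_coord: "L \<in> aff_dom i \<Longrightarrow> pt (emb i \<sigma> (aff_coord i \<sigma> L)) = L"
  by (erule aff_dom_cases) (simp add: aff_coord_pt emb_ratios pt_scale)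

lemma aff_coord_inj: "inj_on (aff_coord i \<sigma>) (aff_dom i)"
  by (metis inj_onI pt_emb_coord)

end

lemma ratios_scale: "c \<noteq> 0 \<Longrightarrow> ratios i \<sigma> (c *s x) = ratios i \<sigma> x"
  by (simp add: ratios_def vec_eq_iff)

lemma cdiff_ratios: "x $ i \<noteq> 0 \<Longrightarrow> cdiff (\<lambda>x. ratios i \<sigma> x $ a) x" for x :: "complex^'n::finite"
  unfolding ratios_def by (simp, intro cdiff_divide cdiff_coord)

lemma chart_subset_points: "(U, \<phi>) \<in> A \<Longrightarrow> U \<subseteq> points A"
  unfolding points_def by (rule subsetI, rule UN_I) auto

lemma proj_atlas_alt:
  "(proj_atlas :: ((complex^'N::finite) set, 'n::finite) chart set)
     = {(aff_dom i, aff_coord i \<sigma>) | i \<sigma>. bij_betw \<sigma> UNIV (UNIV - {i})}"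
  unfolding proj_atlas_def aff_dom_def aff_coord_def[abs_def] by (rule refl)

lemma continuous_on_vecI:
  fixes g :: "'a::topological_space \<Rightarrow> complex^'m::finite"
  assumes "\<And>i. continuous_on S (\<lambda>z. g z $ i)"
  shows "continuous_on S g"
proof -
  have "continuous_on S (\<lambda>z. \<chi> i. g z $ i)" by (rule continuous_on_vec_lambda[OF assms])
  then show ?thesis by simp
qed

lemma open_vimage_ratios:
  fixes W :: "(complex^'n::finite) set" and i :: "'N::finite"
  assumes "open W"
  shows "open {x. x $ i \<noteq> 0 \<and> ratios i \<sigma> x \<in> W}"
proof -
  have "open {x :: complex^'N. x $ i \<noteq> 0}"
    by (rule open_Collect_neq) (intro continuous_intros)+
  moreover have "continuous_on {x :: complex^'N. x $ i \<noteq> 0} (ratios i \<sigma>)"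
    by (rule continuous_on_vecI)
       (auto intro!: continuous_at_imp_continuous_on cdiff_isCont cdiff_ratios)
  ultimately have "open ({x :: complex^'N. x $ i \<noteq> 0} \<inter> ratios i \<sigma> -` W)"
    using assms by (intro continuous_open_preimage)
  moreover have "{x :: complex^'N. x $ i \<noteq> 0} \<inter> ratios i \<sigma> -` W = {x. x $ i \<noteq> 0 \<and> ratios i \<sigma> x \<in> W}"
    by blast
  ultimately show ?thesis by simp
qed

lemma open_vimage_cpoly:
  fixes g :: "complex^'n::finite \<Rightarrow> complex^'m::finite"
  assumes "open V" "\<And>i. cpoly (\<lambda>z. g z $ i)"
  shows "open {z. g z \<in> V}"
proof -
  have "open (g -` V)"
    by (rule open_vimage[OF assms(1)]) (intro continuous_on_vecI cpoly_continuous assms(2))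
  then show ?thesis by (simp add: vimage_def)
qed

text \<open>A polynomial map with a holomorphic local inverse is a legitimate change of
  coordinates on an affine chart: the transitions to and from another affine chart are composites
  of it or its inverse with quotients of linear forms.\<close>
lemma affine_chart_in_max_atlas:
  fixes i :: "'N::finite" and \<sigma> :: "'n::finite \<Rightarrow> 'N" and \<Psi> :: "complex^'n \<Rightarrow> complex^'n"
  assumes \<sigma>: "bij_betw \<sigma> UNIV (UNIV - {i})"
    and \<Psi>: "\<And>a. cpoly (\<lambda>w. \<Psi> w $ a)"
    and W: "open W" "open V" and h: "homeomorphism W V \<Psi> g" and g: "holo_map_on g V"
  shows "({L \<in> aff_dom i. aff_coord i \<sigma> L \<in> W}, \<Psi> \<circ> aff_coord i \<sigma>) \<in> max_atlas proj_atlas"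
proof -
  define U where "U = {L \<in> aff_dom i. aff_coord i \<sigma> L \<in> W}"
  define \<Phi> where "\<Phi> = \<Psi> \<circ> aff_coord i \<sigma>"
  have gW: "g y \<in> W" "\<Psi> (g y) = y" if "y \<in> V" for y
    using h that by (auto simp: homeomorphism_def)
  have \<Psi>V: "\<Psi> w \<in> V" "g (\<Psi> w) = w" if "w \<in> W" for w
    using h that by (auto simp: homeomorphism_def)
  have inj: "inj_on \<Phi> U"
    unfolding \<Phi>_def U_def
    by (rule comp_inj_on, rule inj_on_subset[OF aff_coord_inj[OF \<sigma>]], blast)
       (rule inj_onI, use \<Psi>V(2) in \<open>clarsimp, metis\<close>)
  have ptU: "pt (emb i \<sigma> w) \<in> U \<longleftrightarrow> w \<in> W" for w
    by (simp add: U_def pt_emb[OF \<sigma>])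
  have \<Phi>pt: "\<Phi> (pt (emb i \<sigma> w)) = \<Psi> w" for w
    by (simp add: \<Phi>_def pt_emb[OF \<sigma>])
  have \<Phi>U: "\<Phi> ` U = V"
  proof safe
    show "\<Phi> L \<in> V" if "L \<in> U" for L using that \<Psi>V by (simp add: \<Phi>_def U_def)
    show "y \<in> \<Phi> ` U" if "y \<in> V" for y
      using gW[OF that] ptU \<Phi>pt by (metis image_eqI)
  qed
  have invU: "inv_into U \<Phi> y = pt (emb i \<sigma> (g y))" if "y \<in> V" for y
    using inv_into_f_f[OF inj, of "pt (emb i \<sigma> (g y))"] gW[OF that] by (simp add: ptU \<Phi>pt)
  have sub: "U \<subseteq> points (proj_atlas :: ((complex^'N) set, 'n) chart set)"
  proof -
    have "(aff_dom i, aff_coord i \<sigma>) \<in> proj_atlas" using \<sigma> unfolding proj_atlas_alt by blast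
    from chart_subset_points[OF this] show ?thesis by (auto simp: U_def)
  qed
  have trans: "holo_transition (U, \<Phi>) (aff_dom k, aff_coord k \<tau>)"
      "holo_transition (aff_dom k, aff_coord k \<tau>) (U, \<Phi>)"
    if \<tau>: "bij_betw \<tau> UNIV (UNIV - {k})" for k and \<tau> :: "'n \<Rightarrow> 'N"
  proof -
    have im: "\<Phi> ` (U \<inter> aff_dom k) = V \<inter> (\<lambda>y. emb i \<sigma> (g y) $ k) -` (- {0})"
    proof (intro equalityI subsetI)
      fix y assume "y \<in> \<Phi> ` (U \<inter> aff_dom k)"
      then obtain L where L: "L \<in> U" "L \<in> aff_dom k" and y: "y = \<Phi> L" by blast
      have Lp: "L = pt (emb i \<sigma> (aff_coord i \<sigma> L))" using L(1) by (simp add: U_def pt_emb_coord[OF \<sigma>])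
      have "emb i \<sigma> (aff_coord i \<sigma> L) $ k \<noteq> 0"
        using L(2) Lp pt_in_aff_dom[OF emb_nz[OF \<sigma>]] by metis
      moreover have "g y = aff_coord i \<sigma> L" using L(1) \<Psi>V by (simp add: y \<Phi>_def U_def)
      moreover have "y \<in> V" using L(1) \<Phi>U y by blast
      ultimately show "y \<in> V \<inter> (\<lambda>y. emb i \<sigma> (g y) $ k) -` (- {0})" by simp
    next
      fix y assume "y \<in> V \<inter> (\<lambda>y. emb i \<sigma> (g y) $ k) -` (- {0})"
      then have y: "y \<in> V" "emb i \<sigma> (g y) $ k \<noteq> 0" by auto
      then have "pt (emb i \<sigma> (g y)) \<in> U \<inter> aff_dom k"
        using gW by (simp add: ptU pt_in_aff_dom emb_nz[OF \<sigma>])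
      then show "y \<in> \<Phi> ` (U \<inter> aff_dom k)" using gW[OF y(1)] \<Phi>pt by (metis image_eqI)
    qed
    have cg: "cdiff (\<lambda>y. emb i \<sigma> (g y) $ a) y" if "y \<in> V" for y a
      by (rule cdiff_compose[of g y "\<lambda>w. emb i \<sigma> w $ a"])
         (use g that in \<open>auto simp: holo_map_on_def holo_on_cdiff intro: cpoly_cdiff cpoly_emb[OF \<sigma>]\<close>)
    have opn: "open (\<Phi> ` (U \<inter> aff_dom k))"
      unfolding im
      by (rule continuous_open_preimage)
         (use W(2) cg in \<open>auto intro!: continuous_at_imp_continuous_on cdiff_isCont\<close>)
    moreover have "holo_map_on (aff_coord k \<tau> \<circ> inv_into U \<Phi>) (\<Phi> ` (U \<inter> aff_dom k))"
      unfolding holo_map_on_def holo_on_cdiff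
    proof (intro allI ballI)
      fix a y assume y: "y \<in> \<Phi> ` (U \<inter> aff_dom k)"
      show "cdiff (\<lambda>z. (aff_coord k \<tau> \<circ> inv_into U \<Phi>) z $ a) y"
      proof (rule cdiff_transform[OF _ opn y])
        show "cdiff (\<lambda>y. ratios k \<tau> (emb i \<sigma> (g y)) $ a) y"
          by (rule cdiff_compose[of "\<lambda>y. emb i \<sigma> (g y)" y "\<lambda>x. ratios k \<tau> x $ a"])
             (use y in \<open>auto simp: im intro!: cg cdiff_ratios\<close>)
        show "ratios k \<tau> (emb i \<sigma> (g z)) $ a = (aff_coord k \<tau> \<circ> inv_into U \<Phi>) z $ a"
          if "z \<in> \<Phi> ` (U \<inter> aff_dom k)" for z
          using that by (simp add: im invU aff_coord_pt)
      qed
    qed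
    ultimately show "holo_transition (U, \<Phi>) (aff_dom k, aff_coord k \<tau>)" by simp
    let ?S = "{v. emb k \<tau> v \<in> {x. x $ i \<noteq> 0 \<and> ratios i \<sigma> x \<in> W}}"
    have im': "aff_coord k \<tau> ` (aff_dom k \<inter> U) = ?S"
    proof (intro equalityI subsetI)
      fix v assume "v \<in> aff_coord k \<tau> ` (aff_dom k \<inter> U)"
      then obtain L where L: "L \<in> aff_dom k" "L \<in> U" and v: "v = aff_coord k \<tau> L" by blast
      have Lp: "L = pt (emb k \<tau> v)" using L(1) by (simp add: v pt_emb_coord[OF \<tau>])
      have "L \<in> aff_dom i" "aff_coord i \<sigma> L \<in> W" using L(2) by (auto simp: U_def)
      then have nz: "emb k \<tau> v $ i \<noteq> 0" using Lp pt_in_aff_dom[OF emb_nz[OF \<tau>]] by metis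
      moreover have "ratios i \<sigma> (emb k \<tau> v) \<in> W"
        using aff_coord_pt[OF nz, of \<sigma>] Lp \<open>aff_coord i \<sigma> L \<in> W\<close> by metis
      ultimately show "v \<in> ?S" by simp
    next
      fix v assume "v \<in> ?S"
      then have v: "emb k \<tau> v $ i \<noteq> 0" "ratios i \<sigma> (emb k \<tau> v) \<in> W" by auto
      have "pt (emb k \<tau> v) \<in> aff_dom k \<inter> U"
        using v by (simp add: U_def pt_emb[OF \<tau>] pt_in_aff_dom emb_nz[OF \<tau>] aff_coord_pt)
      then show "v \<in> aff_coord k \<tau> ` (aff_dom k \<inter> U)"
        using pt_emb(2)[OF \<tau>] by (metis image_eqI)
    qed
    have opn': "open (aff_coord k \<tau> ` (aff_dom k \<inter> U))"
      unfolding im' by (intro open_vimage_cpoly open_vimage_ratios W cpoly_emb[OF \<tau>])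
    moreover have "holo_map_on (\<Phi> \<circ> inv_into (aff_dom k) (aff_coord k \<tau>)) (aff_coord k \<tau> ` (aff_dom k \<inter> U))"
      unfolding holo_map_on_def holo_on_cdiff
    proof (intro allI ballI)
      fix a v assume v: "v \<in> aff_coord k \<tau> ` (aff_dom k \<inter> U)"
      show "cdiff (\<lambda>z. (\<Phi> \<circ> inv_into (aff_dom k) (aff_coord k \<tau>)) z $ a) v"
      proof (rule cdiff_transform[OF _ opn' v])
        have "cdiff (\<lambda>v. ratios i \<sigma> (emb k \<tau> v) $ b) v" for b
          by (rule cdiff_compose[of "emb k \<tau>" v "\<lambda>x. ratios i \<sigma> x $ b"])
             (use v in \<open>auto simp: im' intro!: cdiff_ratios intro: cpoly_cdiff cpoly_emb[OF \<tau>]\<close>)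
        then show "cdiff (\<lambda>v. \<Psi> (ratios i \<sigma> (emb k \<tau> v)) $ a) v"
          by (rule cdiff_compose[of "\<lambda>v. ratios i \<sigma> (emb k \<tau> v)" v "\<lambda>w. \<Psi> w $ a"])
             (intro cpoly_cdiff \<Psi>)
        show "\<Psi> (ratios i \<sigma> (emb k \<tau> z)) $ a = (\<Phi> \<circ> inv_into (aff_dom k) (aff_coord k \<tau>)) z $ a"
          if z: "z \<in> aff_coord k \<tau> ` (aff_dom k \<inter> U)" for z
        proof -
          have "inv_into (aff_dom k) (aff_coord k \<tau>) z = pt (emb k \<tau> z)"
            using inv_into_f_f[OF aff_coord_inj[OF \<tau>] pt_emb(1)[OF \<tau>]] by (simp add: pt_emb[OF \<tau>])
          then show ?thesis using z by (simp add: im' \<Phi>_def aff_coord_pt)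
        qed
      qed
    qed
    ultimately show "holo_transition (aff_dom k, aff_coord k \<tau>) (U, \<Phi>)" by simp
  qed
  have "(U, \<Phi>) \<in> max_atlas proj_atlas"
    unfolding max_atlas_def using sub inj W(2) trans by (auto simp: \<Phi>U proj_atlas_alt)
  then show ?thesis by (simp add: U_def \<Phi>_def)
qed

section \<open>Charts of a smooth hypersurface\<close>

text \<open>The derivative at \<open>x\<close> in direction \<open>v\<close> of the affine
  coordinates \<open>ratios i \<tau>\<close>: a constant vector \<open>v\<close> gives at every
  point \<open>pt x\<close> a tangent vector of projective space, with a denominator that makes it
  homogeneous of degree \<open>-1\<close> in \<open>x\<close>. This is the source of the
  negativity in the proof.\<close>
definition slope :: "'N \<Rightarrow> ('n \<Rightarrow> 'N) \<Rightarrow> complex^'N \<Rightarrow> complex^'N \<Rightarrow> complex^'n" where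
  "slope i \<tau> x v = (\<chi> a. (v $ \<tau> a - x $ \<tau> a / x $ i * v $ i) / x $ i)"

lemma slope_add: "slope i \<tau> x (v + w) = slope i \<tau> x v + slope i \<tau> x w"
  by (simp add: slope_def vec_eq_iff add_divide_distrib diff_divide_distrib algebra_simps)

lemma slope_scale: "slope i \<tau> x (c *s v) = c *s slope i \<tau> x v"
  by (simp add: slope_def vec_eq_iff diff_divide_distrib algebra_simps)

lemma slope_scale_point: "c \<noteq> 0 \<Longrightarrow> slope i \<tau> (c *s x) v = (1 / c) *s slope i \<tau> x v"
  by (simp add: slope_def vec_eq_iff field_simps)

lemma cdiff_slope: "x $ i \<noteq> 0 \<Longrightarrow> cdiff (\<lambda>x. slope i \<tau> x v $ a) x" for x :: "complex^'n::finite"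
  unfolding slope_def by (simp, intro cdiff_divide cdiff_diff cdiff_mult cdiff_const cdiff_coord) auto

lemma cpoly_directional_derivative:
  assumes "cpoly f"
  shows "((\<lambda>s. f (x + s *s v)) has_field_derivative differential f x v) (at 0)"
proof -
  have "((\<lambda>s. (x + s *s v) $ i) has_field_derivative v $ i) (at 0)" for i
    by (auto intro!: derivative_eq_intros)
  from cpoly_curve_derivative[OF assms this] show ?thesis by (simp add: differential_def)
qed

locale smooth_threefold =
  fixes F :: "complex^5 \<Rightarrow> complex" and d :: nat and X :: "(complex^5) set set"
  assumes F_homogeneous: "homogeneous_poly d F"
    and F_smooth: "\<And>z. z \<noteq> 0 \<Longrightarrow> F z = 0 \<Longrightarrow> \<exists>i. partial i F z \<noteq> 0"
    and X_eq: "X = {L \<in> proj_space. \<forall>z\<in>L. F z = 0}"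
begin

lemma F_poly: "cpoly F"
proof -
  obtain c where "F = (\<lambda>z. \<Sum>\<alpha> | (\<Sum>i\<in>UNIV. \<alpha> i) = d. c \<alpha> * (\<Prod>i\<in>UNIV. z $ i ^ \<alpha> i))"
    using F_homogeneous by (auto simp: homogeneous_poly_def)
  then show ?thesis
    by simp (intro cpoly_sum cpoly.cpoly_mult cpoly.cpoly_const cpoly_prod cpoly_power cpoly.cpoly_coord)
qed

lemma F_scale: "F (t *s z) = t ^ d * F z"
proof -
  obtain c where F: "F = (\<lambda>z. \<Sum>\<alpha> | (\<Sum>i\<in>UNIV. \<alpha> i) = d. c \<alpha> * (\<Prod>i\<in>UNIV. z $ i ^ \<alpha> i))"
    using F_homogeneous by (auto simp: homogeneous_poly_def)
  have "(\<Prod>i\<in>UNIV. (t * z $ i) ^ \<alpha> i) = t ^ d * (\<Prod>i\<in>UNIV. z $ i ^ \<alpha> i)"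
    if "(\<Sum>i\<in>UNIV. \<alpha> i) = d" for \<alpha> :: "5 \<Rightarrow> nat"
    by (simp add: power_mult_distrib prod.distrib flip: power_sum that)
  then show ?thesis
    unfolding F sum_distrib_left by (intro sum.cong refl) (simp add: mult.left_commute)
qed

lemma differential_scale_point: "t * differential F (t *s x) v = t ^ d * differential F x v"
proof -
  have "((\<lambda>s. F (t *s x + s *s (t *s v))) has_field_derivative differential F (t *s x) (t *s v)) (at 0)"
    by (rule cpoly_directional_derivative[OF F_poly])
  moreover have "((\<lambda>s. t ^ d * F (x + s *s v)) has_field_derivative t ^ d * differential F x v) (at 0)"
    by (intro DERIV_cmult cpoly_directional_derivative F_poly)
  moreover have "F (t *s x + s *s (t *s v)) = t ^ d * F (x + s *s v)" for s
  proof -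
    have "t *s x + s *s (t *s v) = t *s (x + s *s v)" by (simp add: vec_eq_iff algebra_simps)
    then show ?thesis by (simp only: F_scale)
  qed
  ultimately have "differential F (t *s x) (t *s v) = t ^ d * differential F x v"
    by (auto intro: DERIV_unique)
  then show ?thesis by (simp add: differential_scale)
qed

text \<open>Euler's relation on the cone \<open>F = 0\<close>, along which \<open>F\<close> is
  constant in radial directions.\<close>
lemma euler: "F x = 0 \<Longrightarrow> differential F x x = 0"
proof -
  assume x: "F x = 0"
  have "((\<lambda>s. F (x + s *s x)) has_field_derivative differential F x x) (at 0)"
    by (rule cpoly_directional_derivative[OF F_poly])
  moreover have "F (x + s *s x) = 0" for s
  proof -
    have "x + s *s x = (1 + s) *s x" by (simp add: vec_eq_iff algebra_simps)
    then show ?thesis by (simp only: F_scale x mult_zero_right)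
  qed
  ultimately show ?thesis using DERIV_unique[OF _ DERIV_const] by simp
qed

lemma pt_in_X: "x \<noteq> 0 \<Longrightarrow> pt x \<in> X \<longleftrightarrow> F x = 0"
  using pt_mem(2)[of x] by (auto simp: X_eq proj_space_iff pt_def F_scale)

lemma X_cases:
  assumes "L \<in> X"
  obtains x where "x \<noteq> 0" "F x = 0" "L = pt x"
  using assms pt_in_X by (metis (no_types, lifting) X_eq mem_Collect_eq proj_space_iff)

lemma differential_nonzero:
  assumes "x \<noteq> 0" "F x = 0"
  shows "\<exists>v. differential F x v = c"
proof -
  obtain i where "partial i F x \<noteq> 0" using F_smooth assms by blast
  then have "differential F x (axis i (c / partial i F x)) = c" by (simp add: differential_axis)
  then show ?thesis by blast
qed

text \<open>Near a point with \<open>x\<^sub>i \<noteq> 0\<close>, Euler's relation provides an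
  index \<open>j \<noteq> i\<close> with \<open>\<partial>F/\<partial>x\<^sub>j \<noteq>
  0\<close>. In an affine chart \<open>x\<^sub>i = 1\<close>, replacing the coordinate
  \<open>x\<^sub>j\<close> by \<open>F\<close> straightens the hypersurface, so the other three
  affine coordinates form a chart of it. Everything is recorded on an open cone \<open>G\<close>
  in the ambient vector space; the cone contains points off the hypersurface, so that functions
  given in the chart extend holomorphically to \<open>G\<close>.\<close>
lemma affine_chart_ex:
  assumes x0: "x0 \<noteq> 0" "F x0 = 0"
  obtains i :: 5 and \<tau> :: "3 \<Rightarrow> 5" and U G where
    "(U, aff_coord i \<tau>) \<in> hypersurface_atlas X" "open G" "x0 \<in> G"
    "\<And>x c. x \<in> G \<Longrightarrow> c \<noteq> 0 \<Longrightarrow> c *s x \<in> G" "\<And>x. x \<in> G \<Longrightarrow> x $ i \<noteq> 0"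
    "\<And>x. x \<in> G \<Longrightarrow> F x = 0 \<Longrightarrow> pt x \<in> U" "\<And>x. x \<in> G \<Longrightarrow> ratios i \<tau> x \<in> aff_coord i \<tau> ` U"
    "\<And>x \<xi>. x \<in> G \<Longrightarrow> F x = 0 \<Longrightarrow> \<exists>v. differential F x v = 0 \<and> slope i \<tau> x v = \<xi>"
proof -
  obtain i where i: "x0 $ i \<noteq> 0" using x0(1) by (metis vec_eq_iff zero_index)
  have "\<exists>j. j \<noteq> i \<and> partial j F x0 \<noteq> 0"
  proof (rule ccontr)
    assume "\<not> ?thesis"
    then have *: "partial j F x0 = 0" if "j \<noteq> i" for j using that by blast
    have "0 = differential F x0 x0" by (simp add: euler x0(2))
    also have "\<dots> = (\<Sum>j\<in>UNIV. if j = i then partial i F x0 * x0 $ i else 0)"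
      unfolding differential_def by (rule sum.cong) (auto simp: *)
    also have "\<dots> = partial i F x0 * x0 $ i" by simp
    finally have "partial i F x0 = 0" using i by simp
    with * F_smooth[OF x0] show False by metis
  qed
  then obtain j where j: "j \<noteq> i" "partial j F x0 \<noteq> 0" by blast
  have "\<exists>\<sigma>. bij_betw \<sigma> (UNIV :: 4 set) (UNIV - {i})"
    by (rule finite_same_card_bij) (auto simp: card_Diff_singleton)
  then obtain \<sigma> :: "4 \<Rightarrow> 5" where \<sigma>: "bij_betw \<sigma> UNIV (UNIV - {i})" by blast
  note ci = chart_index[OF \<sigma>]
  define j' where "j' = inv_into UNIV \<sigma> j"
  have j': "\<sigma> j' = j" using ci(3) j(1) by (simp add: j'_def)
  have "\<exists>\<iota>. bij_betw \<iota> (UNIV :: 3 set) (UNIV - {j'})"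
    by (rule finite_same_card_bij) (auto simp: card_Diff_singleton)
  then obtain \<iota> :: "3 \<Rightarrow> 4" where \<iota>: "bij_betw \<iota> UNIV (UNIV - {j'})" by blast
  have inj_\<iota>: "inj \<iota>" and range_\<iota>: "range \<iota> = UNIV - {j'}" using \<iota> by (auto simp: bij_betw_def)
  have \<iota>j': "\<iota> a \<noteq> j'" for a using range_\<iota> by blast
  define \<tau> where "\<tau> = \<sigma> \<circ> \<iota>"
  define \<Psi> where "\<Psi> = (\<lambda>w. \<chi> a. if a = j' then F (emb i \<sigma> w) else w $ a)"
  have \<Psi>_poly: "cpoly (\<lambda>w. \<Psi> w $ a)" for a
    by (cases "a = j'")
       (auto simp: \<Psi>_def intro: cpoly_compose[OF F_poly] cpoly_emb[OF \<sigma>] cpoly.cpoly_coord)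
  define w0 where "w0 = ratios i \<sigma> x0"
  have emb_w0: "emb i \<sigma> w0 = (1 / x0 $ i) *s x0" unfolding w0_def by (rule emb_ratios[OF \<sigma> i])
  have part_scale: "partial k F (c *s x) \<noteq> 0 \<longleftrightarrow> partial k F x \<noteq> 0" if "c \<noteq> 0" for c x k
    using differential_scale_point[of c x "axis k 1"] that by (auto simp: differential_axis)
  have Fj: "partial j F (emb i \<sigma> w0) \<noteq> 0"
    unfolding emb_w0 using part_scale[of "1 / x0 $ i" j x0] i j(2) by simp
  have part_emb: "partial a (\<lambda>w. F (emb i \<sigma> w)) w = partial (\<sigma> a) F (emb i \<sigma> w)" for a w
    by (simp add: partial_def emb_add_axis[OF \<sigma>])
  have part_coord: "partial b (\<lambda>w::complex^4. w $ a) w = (if a = b then 1 else 0)" for a b w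
    by (simp add: partial_def axis_def)
  have "det (\<chi> a b. partial b (\<lambda>w. \<Psi> w $ a) w0) \<noteq> 0"
  proof (rule det_nz_if_inj)
    fix v :: "complex^4" assume "(\<chi> a b. partial b (\<lambda>w. \<Psi> w $ a) w0) *v v = 0"
    then have *: "(\<Sum>b\<in>UNIV. partial b (\<lambda>w. \<Psi> w $ a) w0 * v $ b) = 0" for a
      by (simp add: matrix_vector_mult_def vec_eq_iff)
    have va: "v $ a = 0" if "a \<noteq> j'" for a
      using *[of a] that by (simp add: \<Psi>_def part_coord if_distrib[of "\<lambda>x. x * _"] cong: if_cong)
    have "0 = (\<Sum>b\<in>UNIV. partial (\<sigma> b) F (emb i \<sigma> w0) * v $ b)"
      using *[of j'] by (simp add: \<Psi>_def part_emb)
    also have "\<dots> = (\<Sum>b\<in>UNIV. if b = j' then partial j F (emb i \<sigma> w0) * v $ j' else 0)"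
      by (rule sum.cong) (auto simp: va j')
    also have "\<dots> = partial j F (emb i \<sigma> w0) * v $ j'" by simp
    finally have "v $ j' = 0" using Fj by simp
    with va show "v = 0" by (metis vec_eq_iff zero_index)
  qed
  then obtain W V g where W: "open W" "w0 \<in> W" "open V" "homeomorphism W V \<Psi> g" "holo_map_on g V"
    using cpoly_local_inverse[OF \<Psi>_poly] by blast
  have \<Psi>g: "g y \<in> W" "\<Psi> (g y) = y" if "y \<in> V" for y using W(4) that by (auto simp: homeomorphism_def)
  have \<Psi>V: "\<Psi> w \<in> V" if "w \<in> W" for w using W(4) that by (auto simp: homeomorphism_def)
  define U where "U = {L \<in> aff_dom i. aff_coord i \<sigma> L \<in> W}"
  define \<Phi> where "\<Phi> = \<Psi> \<circ> aff_coord i \<sigma>"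
  have max: "(U, \<Phi>) \<in> max_atlas P4_atlas"
    unfolding U_def \<Phi>_def P4_atlas_def by (rule affine_chart_in_max_atlas[OF \<sigma> \<Psi>_poly W(1,3,4,5)])
  have \<Phi>\<iota>: "\<Phi> L $ \<iota> a = aff_coord i \<tau> L $ a" for L a
    by (simp add: \<Phi>_def \<Psi>_def \<iota>j' aff_coord_def \<tau>_def)
  have \<Phi>j': "\<Phi> L $ j' = 0 \<longleftrightarrow> L \<in> X" if "L \<in> U" for L
  proof -
    have "L = pt (emb i \<sigma> (aff_coord i \<sigma> L))" using that by (simp add: U_def pt_emb_coord[OF \<sigma>])
    then have "L \<in> X \<longleftrightarrow> F (emb i \<sigma> (aff_coord i \<sigma> L)) = 0"
      using pt_in_X[OF emb_nz[OF \<sigma>]] by metis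
    then show ?thesis by (simp add: \<Phi>_def \<Psi>_def)
  qed
  have not_range: "k \<notin> range \<iota> \<longleftrightarrow> k = j'" for k using range_\<iota> by auto
  have "\<Phi> ` (U \<inter> X) = {w \<in> \<Phi> ` U. \<forall>k. k \<notin> range \<iota> \<longrightarrow> w $ k = 0}"
    unfolding not_range using \<Phi>j' by auto
  then have "(U \<inter> X, \<lambda>L. \<chi> a. \<Phi> L $ \<iota> a) \<in> hypersurface_atlas X"
    unfolding hypersurface_atlas_def submanifold_atlas_def using max inj_\<iota> by blast
  then have chart: "(U \<inter> X, aff_coord i \<tau>) \<in> hypersurface_atlas X"
    by (simp add: \<Phi>\<iota>)
  \<comment> \<open>The chart coordinates of the point of the hypersurface below \<open>x\<close>, obtained by forgetting the
      value of \<open>F\<close>.\<close>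
  define ext where "ext = (\<lambda>x::complex^5. \<chi> a. if a = j' then 0 else ratios i \<sigma> x $ a)"
  define G where "G = {x. x $ i \<noteq> 0 \<and> ratios i \<sigma> x \<in> W} \<inter> {x. x $ i \<noteq> 0 \<and> ratios i \<sigma> x \<in> {w. (\<chi> a. if a = j' then 0 else w $ a) \<in> V}}
      \<inter> {x. partial j F x \<noteq> 0}"
  have GD: "x $ i \<noteq> 0" "ratios i \<sigma> x \<in> W" "ext x \<in> V" "partial j F x \<noteq> 0" if "x \<in> G" for x
    using that by (auto simp: G_def ext_def)
  show ?thesis
  proof (rule that[OF chart])
    show "open G"
      unfolding G_def
    proof (intro open_Int open_vimage_ratios W(1))
      show "open {w. (\<chi> a. if a = j' then 0 else w $ a) \<in> V}"
      proof (rule open_vimage_cpoly[OF W(3)])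
        show "cpoly (\<lambda>z. (\<chi> a. if a = j' then 0 else z $ a) $ a)" for a
          by (cases "a = j'") (auto intro: cpoly.intros)
      qed
      show "open {x. partial j F x \<noteq> 0}"
        by (rule open_Collect_neq) (intro cpoly_continuous cpoly_partial(1) F_poly continuous_on_const)+
    qed
    have "F (emb i \<sigma> w0) = 0" by (simp add: emb_w0 F_scale x0(2))
    then have "\<Psi> w0 = (\<chi> a. if a = j' then 0 else w0 $ a)" by (simp add: \<Psi>_def vec_eq_iff)
    then show "x0 \<in> G" using i W(2) \<Psi>V[OF W(2)] j(2)
      unfolding G_def Int_iff mem_Collect_eq w0_def[symmetric] by simp
    show "c *s x \<in> G" if "x \<in> G" "c \<noteq> 0" for x c
      using that part_scale[OF that(2)]
      unfolding G_def Int_iff mem_Collect_eq ratios_scale[OF that(2)] by simp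
    show "x $ i \<noteq> 0" if "x \<in> G" for x using GD that by blast
    show "pt x \<in> U \<inter> X" if "x \<in> G" "F x = 0" for x
    proof -
      have "x \<noteq> 0" using GD(1)[OF that(1)] by auto
      then show ?thesis using GD[OF that(1)] that(2) by (simp add: U_def pt_in_aff_dom aff_coord_pt pt_in_X)
    qed
    show "ratios i \<tau> x \<in> aff_coord i \<tau> ` (U \<inter> X)" if "x \<in> G" for x
    proof -
      let ?w = "g (ext x)" and ?L = "pt (emb i \<sigma> (g (ext x)))"
      have w: "?w \<in> W" "\<Psi> ?w = ext x" using \<Psi>g GD(3)[OF that] by auto
      then have LU: "?L \<in> U" by (simp add: U_def pt_emb[OF \<sigma>])
      have \<Phi>L: "\<Phi> ?L = ext x" by (simp add: \<Phi>_def pt_emb[OF \<sigma>] w)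
      then have "?L \<in> X" using \<Phi>j'[OF LU] by (simp add: ext_def)
      moreover have "aff_coord i \<tau> ?L = ratios i \<tau> x"
      proof -
        have "aff_coord i \<tau> ?L $ a = ext x $ \<iota> a" for a using \<Phi>\<iota>[of ?L a] by (simp only: \<Phi>L)
        then show ?thesis by (simp add: vec_eq_iff ext_def \<iota>j') (simp add: ratios_def \<tau>_def)
      qed
      ultimately show ?thesis using LU by (metis IntI image_eqI)
    qed
    show "\<exists>v. differential F x v = 0 \<and> slope i \<tau> x v = \<xi>" if "x \<in> G" "F x = 0" for x \<xi>
    proof -
      define u :: "complex^5" where
        "u = (\<chi> k. if k \<in> range \<tau> then x $ i * \<xi> $ inv_into UNIV \<tau> k else 0)"
      define v where "v = u + axis j (- differential F x u / partial j F x)"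
      have inj_\<tau>: "inj \<tau>" unfolding \<tau>_def using inj_\<iota> ci(4) by (intro inj_compose) (auto intro: injI)
      have \<tau>i: "\<tau> a \<noteq> i" "\<tau> a \<noteq> j" for a
        using ci(1) ci(4)[of "\<iota> a" j'] \<iota>j' by (auto simp: \<tau>_def j')
      have "differential F x v = 0"
        using GD(4)[OF that(1)] by (simp add: v_def differential_add differential_axis)
      moreover have "v $ i = 0" using \<tau>i(1) j(1) by (auto simp: v_def u_def axis_def)
      moreover have "v $ \<tau> a = x $ i * \<xi> $ a" for a
        using \<tau>i(2)[of a] inj_\<tau> by (simp add: v_def u_def axis_def)
      ultimately show ?thesis
        using GD(1)[OF that(1)] by (intro exI[of _ v]) (simp add: slope_def vec_eq_iff)
    qed
  qed
qed

end

section \<open>Local expressions of jet differentials\<close>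

lemma analytic_at_eventually_eq:
  assumes "f analytic_on {z}" "\<forall>\<^sub>F t in nhds z. f t = g t"
  shows "g analytic_on {z}"
proof -
  obtain S where S: "open S" "z \<in> S" "f holomorphic_on S" using assms(1) by (auto simp: analytic_at)
  obtain T where T: "open T" "z \<in> T" "\<And>t. t \<in> T \<Longrightarrow> f t = g t"
    using assms(2) by (auto simp: eventually_nhds)
  have "f holomorphic_on (S \<inter> T)" using S(3) by (rule holomorphic_on_subset) blast
  then have "g holomorphic_on (S \<inter> T)" using T(3) by (metis (no_types, lifting) IntD2 holomorphic_cong)
  then show ?thesis unfolding analytic_at using S T by (intro exI[of _ "S \<inter> T"]) auto
qed

definition monomial2 :: "(nat \<Rightarrow> 'n::finite \<Rightarrow> nat) \<Rightarrow> complex^'n \<Rightarrow> complex^'n \<Rightarrow> complex" where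
  "monomial2 \<alpha> \<xi> \<eta> = (\<Prod>a\<in>UNIV. \<xi> $ a ^ \<alpha> 1 a) * (\<Prod>a\<in>UNIV. \<eta> $ a ^ \<alpha> 2 a)"

lemma jet_monomial_2:
  "jet_monomial 2 \<alpha> \<zeta> = monomial2 \<alpha> (\<chi> a. \<zeta> 1 a) (\<chi> a. \<zeta> 2 a)"
proof -
  have "{1..2::nat} = {1, 2}" by auto
  then show ?thesis by (simp add: jet_monomial_def monomial2_def)
qed

lemma jet_exponents_2:
  "\<alpha> \<in> jet_exponents 2 m \<Longrightarrow> (\<Sum>a\<in>UNIV. \<alpha> 1 a) + 2 * (\<Sum>a\<in>UNIV. \<alpha> 2 a) = m"
proof -
  have "{1..2::nat} = {1, 2}" by auto
  then show "\<alpha> \<in> jet_exponents 2 m \<Longrightarrow> ?thesis" by (simp add: jet_exponents_def)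
qed

lemma monomial2_scale:
  "monomial2 \<alpha> (c *s \<xi>) (e *s \<eta>) =
     c ^ (\<Sum>a\<in>UNIV. \<alpha> 1 a) * e ^ (\<Sum>a\<in>UNIV. \<alpha> 2 a) * monomial2 \<alpha> \<xi> \<eta>"
  by (simp add: monomial2_def power_mult_distrib prod.distrib power_sum)

text \<open>The part of a local expression that has degree \<open>b\<close> in the second
  derivatives \<open>\<eta>\<close>; since the weighted degree is \<open>m\<close>, its degree in
  the first derivatives \<open>\<xi>\<close> is \<open>m - 2 b\<close>.\<close>
definition layer ::
    "((nat \<Rightarrow> 3 \<Rightarrow> nat) \<Rightarrow> complex^3 \<Rightarrow> complex) \<Rightarrow> nat \<Rightarrow> nat \<Rightarrow> complex^3 \<Rightarrow> complex^3 \<Rightarrow> complex^3 \<Rightarrow> complex" where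
  "layer R m b z \<xi> \<eta> =
     (\<Sum>\<alpha> | \<alpha> \<in> jet_exponents 2 m \<and> (\<Sum>a\<in>UNIV. \<alpha> 2 a) = b. R \<alpha> z * monomial2 \<alpha> \<xi> \<eta>)"

lemma sum_layers:
  "(\<Sum>\<alpha>\<in>jet_exponents 2 m. R \<alpha> z * monomial2 \<alpha> \<xi> \<eta>) = (\<Sum>b\<le>m. layer R m b z \<xi> \<eta>)"
proof -
  have "(\<Sum>b\<in>{..m}. \<Sum>\<alpha> | \<alpha> \<in> jet_exponents 2 m \<and> (\<Sum>a\<in>UNIV. \<alpha> 2 a) = b. R \<alpha> z * monomial2 \<alpha> \<xi> \<eta>)
      = (\<Sum>\<alpha>\<in>jet_exponents 2 m. R \<alpha> z * monomial2 \<alpha> \<xi> \<eta>)"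
  proof (rule sum.group[OF finite_jet_exponents finite_atMost])
    show "(\<lambda>\<alpha>. \<Sum>a\<in>UNIV. \<alpha> 2 a) ` (jet_exponents 2 m :: (nat \<Rightarrow> 3 \<Rightarrow> nat) set) \<subseteq> {..m}"
    proof (rule image_subsetI)
      fix \<alpha> :: "nat \<Rightarrow> 3 \<Rightarrow> nat" assume "\<alpha> \<in> jet_exponents 2 m"
      from jet_exponents_2[OF this] show "(\<Sum>a\<in>UNIV. \<alpha> 2 a) \<in> {..m}" by simp
    qed
  qed
  then show ?thesis by (simp add: layer_def)
qed

lemma layer_scale_second: "layer R m b z \<xi> (c *s \<eta>) = c ^ b * layer R m b z \<xi> \<eta>"
proof -
  have "monomial2 \<alpha> \<xi> (c *s \<eta>) = c ^ (\<Sum>a\<in>UNIV. \<alpha> 2 a) * monomial2 \<alpha> \<xi> \<eta>" for \<alpha> :: "nat \<Rightarrow> 3 \<Rightarrow> nat"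
    using monomial2_scale[of \<alpha> 1 \<xi> c \<eta>] by simp
  then show ?thesis unfolding layer_def sum_distrib_left
    by (intro sum.cong refl) (simp add: mult.left_commute)
qed

text \<open>The total degree of a layer is \<open>(m - 2 b) + b\<close>.\<close>
lemma layer_scale_both: "layer R m b z (c *s \<xi>) (c *s \<eta>) = c ^ (m - b) * layer R m b z \<xi> \<eta>"
  unfolding layer_def sum_distrib_left
proof (intro sum.cong refl)
  fix \<alpha> :: "nat \<Rightarrow> 3 \<Rightarrow> nat"
  assume "\<alpha> \<in> {\<alpha> \<in> jet_exponents 2 m. (\<Sum>a\<in>UNIV. \<alpha> 2 a) = b}"
  then have "(\<Sum>a\<in>UNIV. \<alpha> 1 a) + (\<Sum>a\<in>UNIV. \<alpha> 2 a) = m - b"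
    using jet_exponents_2[of \<alpha> m] by auto
  then show "R \<alpha> z * monomial2 \<alpha> (c *s \<xi>) (c *s \<eta>) = c ^ (m - b) * (R \<alpha> z * monomial2 \<alpha> \<xi> \<eta>)"
    by (simp add: monomial2_scale flip: power_add)
qed

lemma layer_empty: "2 * b > m \<Longrightarrow> layer R m b z \<xi> \<eta> = 0"
proof -
  assume b: "2 * b > m"
  have "{\<alpha> :: nat \<Rightarrow> 3 \<Rightarrow> nat. \<alpha> \<in> jet_exponents 2 m \<and> (\<Sum>a\<in>UNIV. \<alpha> 2 a) = b} = {}"
    using b jet_exponents_2 by fastforce
  then show ?thesis by (simp only: layer_def sum.empty)
qed

lemma tendsto_layer:
  assumes "(\<eta> \<longlongrightarrow> \<eta>0) A"
  shows "((\<lambda>n. layer R m b z \<xi> (\<eta> n)) \<longlongrightarrow> layer R m b z \<xi> \<eta>0) A"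
  unfolding layer_def monomial2_def
  by (intro tendsto_intros tendsto_vec_nth assms)

text \<open>If the layers above \<open>b\<close> vanish, layer \<open>b\<close> is the leading
  coefficient of the whole expression along a line of second derivatives. A limit is used rather
  than a coefficient comparison because it shows at once that the result depends only on the
  values of the expression.\<close>
lemma leading_layer:
  assumes "\<And>b' \<eta>. b < b' \<Longrightarrow> b' \<le> m \<Longrightarrow> layer R m b' z \<xi> \<eta> = 0" and b: "b \<le> m"
  shows "(\<lambda>n. (\<Sum>b'\<le>m. layer R m b' z \<xi> (u + of_nat n *s v)) / of_nat n ^ b)
           \<longlonglongrightarrow> layer R m b z \<xi> v"
proof -
  have inv: "(\<lambda>n. 1 / of_nat n :: complex) \<longlonglongrightarrow> 0" by (rule lim_1_over_n)
  have "(\<lambda>n. v + (1 / of_nat n) *s u) \<longlonglongrightarrow> v"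
  proof (rule vec_tendstoI)
    fix i
    have "(\<lambda>n. v $ i + (1 / of_nat n) * u $ i) \<longlonglongrightarrow> v $ i + 0 * u $ i"
      by (intro tendsto_intros inv)
    then show "(\<lambda>n. (v + (1 / of_nat n) *s u) $ i) \<longlonglongrightarrow> v $ i" by simp
  qed
  then have "(\<lambda>n. \<Sum>b'\<le>b. layer R m b' z \<xi> (v + (1 / of_nat n) *s u) * (1 / of_nat n) ^ (b - b'))
      \<longlonglongrightarrow> (\<Sum>b'\<le>b. layer R m b' z \<xi> v * 0 ^ (b - b'))"
    by (intro tendsto_sum tendsto_mult tendsto_layer tendsto_power inv)
  also have "(\<Sum>b'\<le>b. layer R m b' z \<xi> v * 0 ^ (b - b')) = (\<Sum>b'\<le>b. if b' = b then layer R m b z \<xi> v else 0)"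
    by (intro sum.cong refl) auto
  also have "\<dots> = layer R m b z \<xi> v" by simp
  finally have lim: "(\<lambda>n. \<Sum>b'\<le>b. layer R m b' z \<xi> (v + (1 / of_nat n) *s u) * (1 / of_nat n) ^ (b - b'))
      \<longlonglongrightarrow> layer R m b z \<xi> v" .
  show ?thesis
  proof (rule Lim_transform_eventually[OF lim], rule eventually_mono[OF eventually_gt_at_top[of 0]])
    fix n :: nat assume n: "0 < n"
    let ?n = "of_nat n :: complex"
    have "u + ?n *s v = ?n *s (v + (1 / ?n) *s u)" using n by (simp add: vec_eq_iff field_simps)
    then have "layer R m b' z \<xi> (u + ?n *s v) = ?n ^ b' * layer R m b' z \<xi> (v + (1 / ?n) *s u)" for b'
      by (simp only: layer_scale_second)
    then have "layer R m b' z \<xi> (u + ?n *s v) / ?n ^ b =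
        layer R m b' z \<xi> (v + (1 / ?n) *s u) * (1 / ?n) ^ (b - b')" if "b' \<le> b" for b'
      using n power_diff[of ?n b' b] that by (simp add: power_one_over field_simps)
    then have "(\<Sum>b'\<le>b. layer R m b' z \<xi> (v + (1 / ?n) *s u) * (1 / ?n) ^ (b - b'))
        = (\<Sum>b'\<le>b. layer R m b' z \<xi> (u + ?n *s v)) / ?n ^ b"
      by (simp add: sum_divide_distrib)
    also have "(\<Sum>b'\<le>b. layer R m b' z \<xi> (u + ?n *s v)) = (\<Sum>b'\<le>m. layer R m b' z \<xi> (u + ?n *s v))"
      by (rule sum.mono_neutral_left) (use b assms(1) in auto)
    finally show "(\<Sum>b'\<le>b. layer R m b' z \<xi> (v + (1 / ?n) *s u) * (1 / ?n) ^ (b - b'))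
        = (\<Sum>b'\<le>m. layer R m b' z \<xi> (u + ?n *s v)) / ?n ^ b" .
  qed
qed

lemma cdiff_layer:
  fixes x :: "complex^5"
  assumes x: "x $ i \<noteq> 0"
    and R: "\<And>\<alpha>. \<alpha> \<in> jet_exponents 2 m \<Longrightarrow> cdiff (\<lambda>x. R \<alpha> (ratios i \<tau> x)) x"
  shows "cdiff (\<lambda>x. layer R m b (ratios i \<tau> x) (slope i \<tau> x p) (slope i \<tau> x q)) x"
  unfolding layer_def monomial2_def
  by (intro cdiff_sum cdiff_mult cdiff_prod cdiff_power cdiff_slope x) (use R in auto)

locale jet_differential = smooth_threefold +
  fixes P :: "(complex \<Rightarrow> (complex^5) set) set \<Rightarrow> complex" and m :: nat
  assumes P: "P \<in> global_jet_differentials (hypersurface_atlas X) 2 m"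
begin

abbreviation "jet2 \<equiv> jet (hypersurface_atlas X) 2"

text \<open>A local expression of \<open>P\<close> in a chart of the hypersurface, read on an open
  cone \<open>G\<close> in the ambient space: its coefficients are holomorphic on all of
  \<open>G\<close>, tangent vectors realise every slope, and it evaluates \<open>P\<close> on the
  images of curves in the affine cone with 2-jet \<open>(x, p, q)\<close> as well as on arbitrary
  germs. The correction of \<open>slope i \<tau> x q\<close> by a multiple of \<open>slope i
  \<tau> x p\<close> comes from the quotient rule for the second derivative.\<close>

definition local_expression ::
    "5 \<Rightarrow> (3 \<Rightarrow> 5) \<Rightarrow> (complex^5) set \<Rightarrow> ((nat \<Rightarrow> 3 \<Rightarrow> nat) \<Rightarrow> complex^3 \<Rightarrow> complex) \<Rightarrow> bool" where
  "local_expression i \<tau> G R \<longleftrightarrow> open G \<and> (\<forall>x\<in>G. x $ i \<noteq> 0) \<and>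
     (\<forall>x\<in>G. \<forall>c. c \<noteq> 0 \<longrightarrow> c *s x \<in> G) \<and>
     (\<forall>x\<in>G. \<forall>\<alpha>\<in>jet_exponents 2 m. cdiff (\<lambda>x. R \<alpha> (ratios i \<tau> x)) x) \<and>
     (\<forall>x\<in>G. F x = 0 \<longrightarrow> (\<forall>\<xi>. \<exists>v. differential F x v = 0 \<and> slope i \<tau> x v = \<xi>)) \<and>
     (\<forall>c x p q. has_jet c x p q \<and> x \<in> G \<and> (\<forall>\<^sub>F t in nhds 0. F (c t) = 0) \<longrightarrow>
        P (jet2 (\<lambda>t. pt (c t))) = (\<Sum>b\<le>m. layer R m b (ratios i \<tau> x) (slope i \<tau> x p)
           (slope i \<tau> x q - (2 * p $ i / x $ i) *s slope i \<tau> x p))) \<and>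
     (\<forall>f x. curve_germ (hypersurface_atlas X) f \<and> f 0 = pt x \<and> x \<in> G \<and> F x = 0 \<longrightarrow>
        (\<exists>\<xi> \<eta>. P (jet2 f) = (\<Sum>b\<le>m. layer R m b (ratios i \<tau> x) \<xi> \<eta>)))"

lemma local_expressionD:
  assumes "local_expression i \<tau> G R"
  shows "open G"
    and "x \<in> G \<Longrightarrow> x $ i \<noteq> 0"
    and "x \<in> G \<Longrightarrow> c \<noteq> 0 \<Longrightarrow> c *s x \<in> G"
    and "x \<in> G \<Longrightarrow> \<alpha> \<in> jet_exponents 2 m \<Longrightarrow> cdiff (\<lambda>x. R \<alpha> (ratios i \<tau> x)) x"
    and "x \<in> G \<Longrightarrow> F x = 0 \<Longrightarrow> \<exists>v. differential F x v = 0 \<and> slope i \<tau> x v = \<xi>"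
    and "has_jet \<gamma> x p q \<Longrightarrow> x \<in> G \<Longrightarrow> \<forall>\<^sub>F t in nhds 0. F (\<gamma> t) = 0 \<Longrightarrow>
      P (jet2 (\<lambda>t. pt (\<gamma> t))) = (\<Sum>b\<le>m. layer R m b (ratios i \<tau> x) (slope i \<tau> x p)
           (slope i \<tau> x q - (2 * p $ i / x $ i) *s slope i \<tau> x p))"
    and "curve_germ (hypersurface_atlas X) f \<Longrightarrow> f 0 = pt x \<Longrightarrow> x \<in> G \<Longrightarrow> F x = 0 \<Longrightarrow>
      \<exists>\<xi> \<eta>. P (jet2 f) = (\<Sum>b\<le>m. layer R m b (ratios i \<tau> x) \<xi> \<eta>)"
proof -
  note D = assms[unfolded local_expression_def]
  note D1 = D[THEN conjunct2]
  note D2 = D1[THEN conjunct2]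
  note D3 = D2[THEN conjunct2]
  note D4 = D3[THEN conjunct2]
  note D5 = D4[THEN conjunct2]
  note D6 = D5[THEN conjunct2]
  show "open G" by (rule D[THEN conjunct1])
  show "x \<in> G \<Longrightarrow> x $ i \<noteq> 0" by (rule D1[THEN conjunct1, rule_format])
  show "x \<in> G \<Longrightarrow> c \<noteq> 0 \<Longrightarrow> c *s x \<in> G" by (rule D2[THEN conjunct1, rule_format])
  show "x \<in> G \<Longrightarrow> \<alpha> \<in> jet_exponents 2 m \<Longrightarrow> cdiff (\<lambda>x. R \<alpha> (ratios i \<tau> x)) x"
    by (rule D3[THEN conjunct1, rule_format])
  show "x \<in> G \<Longrightarrow> F x = 0 \<Longrightarrow> \<exists>v. differential F x v = 0 \<and> slope i \<tau> x v = \<xi>"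
    by (rule D4[THEN conjunct1, rule_format])
  show "has_jet \<gamma> x p q \<Longrightarrow> x \<in> G \<Longrightarrow> \<forall>\<^sub>F t in nhds 0. F (\<gamma> t) = 0 \<Longrightarrow>
      P (jet2 (\<lambda>t. pt (\<gamma> t))) = (\<Sum>b\<le>m. layer R m b (ratios i \<tau> x) (slope i \<tau> x p)
           (slope i \<tau> x q - (2 * p $ i / x $ i) *s slope i \<tau> x p))"
    by (rule D5[THEN conjunct1, rule_format]) (intro conjI)
  show "curve_germ (hypersurface_atlas X) f \<Longrightarrow> f 0 = pt x \<Longrightarrow> x \<in> G \<Longrightarrow> F x = 0 \<Longrightarrow>
      \<exists>\<xi> \<eta>. P (jet2 f) = (\<Sum>b\<le>m. layer R m b (ratios i \<tau> x) \<xi> \<eta>)"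
    by (rule D6[rule_format]) (intro conjI)
qed

lemma local_expression_ex:
  assumes x0: "x0 \<noteq> 0" "F x0 = 0"
  shows "\<exists>i \<tau> G R. local_expression i \<tau> G R \<and> x0 \<in> G"
proof -
  obtain i :: 5 and \<tau> :: "3 \<Rightarrow> 5" and U G where
    chart: "(U, aff_coord i \<tau>) \<in> hypersurface_atlas X" and G: "open G" "x0 \<in> G"
    "\<And>x c. x \<in> G \<Longrightarrow> c \<noteq> 0 \<Longrightarrow> c *s x \<in> G" "\<And>x. x \<in> G \<Longrightarrow> x $ i \<noteq> 0"
    and GU: "\<And>x. x \<in> G \<Longrightarrow> F x = 0 \<Longrightarrow> pt x \<in> U"
    and Gr: "\<And>x. x \<in> G \<Longrightarrow> ratios i \<tau> x \<in> aff_coord i \<tau> ` U"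
    and surj: "\<And>x \<xi>. x \<in> G \<Longrightarrow> F x = 0 \<Longrightarrow> \<exists>v. differential F x v = 0 \<and> slope i \<tau> x v = \<xi>"
    by (rule affine_chart_ex[OF x0]) blast
  have UA: "U \<inter> points (hypersurface_atlas X) = U"
    using chart_subset_points[OF chart] by blast
  have "\<forall>(U, \<phi>)\<in>hypersurface_atlas X. \<exists>R :: (nat \<Rightarrow> 3 \<Rightarrow> nat) \<Rightarrow> complex^3 \<Rightarrow> complex.
        (\<forall>\<alpha>\<in>jet_exponents 2 m. holo_on (R \<alpha>) (\<phi> ` (U \<inter> points (hypersurface_atlas X)))) \<and>
        (\<forall>f. curve_germ (hypersurface_atlas X) f \<and> f 0 \<in> U \<inter> points (hypersurface_atlas X) \<longrightarrow>
           P (jet2 f) =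
             (\<Sum>\<alpha>\<in>jet_exponents 2 m. R \<alpha> (\<phi> (f 0)) * jet_monomial 2 \<alpha> (jet_coord \<phi> f)))"
    using P unfolding global_jet_differentials_def invariant_jet_differentials_def by blast
  from bspec[OF this chart] obtain R :: "(nat \<Rightarrow> 3 \<Rightarrow> nat) \<Rightarrow> complex^3 \<Rightarrow> complex" where
    R: "\<And>\<alpha>. \<alpha> \<in> jet_exponents 2 m \<Longrightarrow> holo_on (R \<alpha>) (aff_coord i \<tau> ` U)"
    and PR: "\<And>f. curve_germ (hypersurface_atlas X) f \<Longrightarrow> f 0 \<in> U \<Longrightarrow> P (jet2 f) =
       (\<Sum>\<alpha>\<in>jet_exponents 2 m. R \<alpha> (aff_coord i \<tau> (f 0)) * jet_monomial 2 \<alpha> (jet_coord (aff_coord i \<tau>) f))"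
    unfolding prod.case UA by blast
  have "local_expression i \<tau> G R"
    unfolding local_expression_def
  proof (intro conjI ballI allI impI)
    show "cdiff (\<lambda>x. R \<alpha> (ratios i \<tau> x)) x" if "x \<in> G" "\<alpha> \<in> jet_exponents 2 m" for x \<alpha>
    proof (rule cdiff_compose)
      show "cdiff (\<lambda>z. ratios i \<tau> z $ a) x" for a using G(4)[OF that(1)] by (rule cdiff_ratios)
      show "cdiff (R \<alpha>) (ratios i \<tau> x)" using R[OF that(2)] Gr[OF that(1)] unfolding holo_on_cdiff by blast
    qed
    show "\<exists>\<xi> \<eta>. P (jet2 f) = (\<Sum>b\<le>m. layer R m b (ratios i \<tau> x) \<xi> \<eta>)"
      if "curve_germ (hypersurface_atlas X) f \<and> f 0 = pt x \<and> x \<in> G \<and> F x = 0" for f x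
      using that PR[of f] GU[of x] G(4)[of x]
      by (auto simp: jet_monomial_2 aff_coord_pt sum_layers)
    fix c x p q
    assume *: "has_jet c x p q \<and> x \<in> G \<and> (\<forall>\<^sub>F t in nhds 0. F (c t) = 0)"
    then have c0: "c 0 = x" and can: "\<And>k. (\<lambda>t. c t $ k) analytic_on {0}"
      and c1: "\<And>k. deriv (\<lambda>t. c t $ k) 0 = p $ k" and c2: "\<And>k. deriv (deriv (\<lambda>t. c t $ k)) 0 = q $ k"
      and xG: "x \<in> G" and Fc: "\<forall>\<^sub>F t in nhds 0. F (c t) = 0" by (auto simp: has_jet_def)
    have xi: "x $ i \<noteq> 0" by (rule G(4)[OF xG])
    have Fx: "F x = 0" using eventually_nhds_x_imp_x[OF Fc] c0 by simp
    have "((\<lambda>t. c t $ k) \<longlongrightarrow> x $ k) (nhds 0)" for k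
      using analytic_at_imp_isCont[OF can[of k]] tendsto_at_iff_tendsto_nhds[of "\<lambda>t. c t $ k" 0]
      by (simp add: c0 isCont_def)
    then have "(c \<longlongrightarrow> x) (nhds 0)" by (rule vec_tendstoI)
    then have cG: "\<forall>\<^sub>F t in nhds 0. c t \<in> G" using G(1) xG by (rule topological_tendstoD)
    let ?f = "\<lambda>t. pt (c t)"
    define u where "u = (\<lambda>a t. c t $ \<tau> a / c t $ i)"
    have fu: "\<forall>\<^sub>F t in nhds 0. u a t = aff_coord i \<tau> (?f t) $ a" for a
      using cG by (rule eventually_mono) (simp add: u_def aff_coord_pt G(4) ratios_def)
    have u_an: "u a analytic_on {0}" for a
      unfolding u_def by (rule analytic_on_divide[OF can can]) (simp add: c0 xi)
    have germ: "curve_germ (hypersurface_atlas X) ?f"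
      unfolding curve_germ_def
    proof (rule bexI[OF _ chart], simp only: prod.case, intro conjI allI)
      show "\<forall>\<^sub>F t in nhds 0. pt (c t) \<in> U"
        using cG Fc by eventually_elim (rule GU)
      show "(\<lambda>t. aff_coord i \<tau> (pt (c t)) $ a) analytic_on {0}" for a
        by (rule analytic_at_eventually_eq[OF u_an fu])
    qed
    have ci0: "c 0 $ i \<noteq> 0" by (simp add: c0 xi)
    have J: "jet_coord (aff_coord i \<tau>) ?f j a = (deriv ^^ j) (u a) 0" for j a
      unfolding jet_coord_def
      by (rule higher_deriv_cong_ev[OF eventually_mono[OF fu[of a]] refl]) simp
    have D1: "deriv (u a) 0 = slope i \<tau> x p $ a" for a
      using deriv_quotient(1)[OF can can ci0, of "\<tau> a"] by (simp add: u_def c0 c1 slope_def)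
    have D2: "deriv (deriv (u a)) 0 = (slope i \<tau> x q - (2 * p $ i / x $ i) *s slope i \<tau> x p) $ a" for a
    proof -
      have "deriv (deriv (u a)) 0 =
          (q $ \<tau> a - 2 * slope i \<tau> x p $ a * p $ i - x $ \<tau> a / x $ i * q $ i) / x $ i"
        using deriv_quotient(2)[OF can can ci0, of "\<tau> a"] D1[of a] by (simp add: u_def c0 c1 c2)
      also have "\<dots> = (slope i \<tau> x q - (2 * p $ i / x $ i) *s slope i \<tau> x p) $ a"
        using xi by (simp add: slope_def[of _ _ _ q] diff_divide_distrib)
      finally show ?thesis .
    qed
    have "jet_monomial 2 \<alpha> (jet_coord (aff_coord i \<tau>) ?f) = monomial2 \<alpha> (slope i \<tau> x p)
        (slope i \<tau> x q - (2 * p $ i / x $ i) *s slope i \<tau> x p)" for \<alpha>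
    proof -
      have "(\<chi> a. jet_coord (aff_coord i \<tau>) ?f 1 a) = slope i \<tau> x p"
        by (simp add: J D1 vec_eq_iff)
      moreover have "(\<chi> a. jet_coord (aff_coord i \<tau>) ?f 2 a) =
          slope i \<tau> x q - (2 * p $ i / x $ i) *s slope i \<tau> x p"
        unfolding J numeral_2_eq_2 by (simp add: D2 vec_eq_iff del: vector_minus_component)
      ultimately show ?thesis by (simp only: jet_monomial_2)
    qed
    then show "P (jet2 ?f) = (\<Sum>b\<le>m. layer R m b (ratios i \<tau> x) (slope i \<tau> x p)
           (slope i \<tau> x q - (2 * p $ i / x $ i) *s slope i \<tau> x p))"
      using PR[OF germ] GU[OF xG Fx] by (simp add: c0 aff_coord_pt xi sum_layers)
  qed (use G surj in auto)
  with G(2) show ?thesis by blast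
qed

end

section \<open>Vanishing\<close>

lemma inner_complex_vec: "x \<bullet> y = Re (\<Sum>k\<in>UNIV. cnj (y $ k) * x $ k)" for x y :: "complex^'n::finite"
  by (simp add: inner_vec_def inner_complex_def algebra_simps)

lemma norm_complex_vec: "complex_of_real ((norm x)\<^sup>2) = (\<Sum>k\<in>UNIV. cnj (x $ k) * x $ k)"
  for x :: "complex^'n::finite"
proof -
  have "(norm x)\<^sup>2 = (\<Sum>k\<in>UNIV. (norm (x $ k))\<^sup>2)"
    by (simp add: norm_vec_def L2_set_def sum_nonneg)
  then show ?thesis
    by (simp only: of_real_sum complex_norm_square) (simp add: mult.commute)
qed

lemma norm_scale_complex_vec: "norm (c *s x) = norm c * norm x" for x :: "complex^'n::finite"
  by (simp add: norm_vec_def norm_mult L2_set_right_distrib)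

text \<open>The affine hyperplane \<open>\<langle>x, y\<rangle> = 1\<close> touches the unit
  sphere only at \<open>y\<close>.\<close>
lemma norm_gt_1_on_tangent_plane:
  fixes x y :: "complex^'n::finite"
  assumes "norm y = 1" "(\<Sum>k\<in>UNIV. cnj (y $ k) * x $ k) = 1" "x \<noteq> y"
  shows "norm x > 1"
proof -
  have "0 < (norm (x - y))\<^sup>2" using assms(3) by simp
  also have "\<dots> = (norm x)\<^sup>2 - 2 * (x \<bullet> y) + (norm y)\<^sup>2"
    by (simp add: power2_norm_eq_inner inner_diff_left inner_diff_right inner_commute)
  also have "\<dots> = (norm x)\<^sup>2 - 1" using assms by (simp add: inner_complex_vec)
  finally have "1\<^sup>2 < (norm x)\<^sup>2" by simp
  then show ?thesis by (rule power_less_imp_less_base) simp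
qed

context jet_differential
begin

text \<open>The points of the cone over the hypersurface at which both fixed vectors
  \<open>p\<close> and \<open>q\<close> are tangent. It is cut out by three equations in five
  variables, so its image in projective space has dimension at least one at each point. This is
  where the order \<open>2\<close> of the jets being less than the dimension \<open>3\<close>
  enters.\<close>
definition polar_cone :: "complex^5 \<Rightarrow> complex^5 \<Rightarrow> (complex^5) set" where
  "polar_cone p q = {x. x \<noteq> 0 \<and> F x = 0 \<and> differential F x p = 0 \<and> differential F x q = 0}"

lemma polar_cone_scale:
  assumes "x \<in> polar_cone p q" "c \<noteq> 0"
  shows "c *s x \<in> polar_cone p q"
  using assms differential_scale_point[of c x p] differential_scale_point[of c x q]
  by (auto simp: polar_cone_def F_scale vec_eq_iff)

definition layers_vanish_above :: "nat \<Rightarrow> bool" where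
  "layers_vanish_above b \<longleftrightarrow> (\<forall>b' i \<tau> G R x \<xi> \<eta>. b < b' \<longrightarrow> b' \<le> m \<longrightarrow>
     local_expression i \<tau> G R \<longrightarrow> x \<in> G \<longrightarrow> F x = 0 \<longrightarrow> layer R m b' (ratios i \<tau> x) \<xi> \<eta> = 0)"

text \<open>Choose \<open>r\<close> such that \<open>(x, p, r)\<close> is the 2-jet of a curve in
  the cone. Then so is \<open>(x, p, r + n q)\<close> for every \<open>n\<close>, because
  \<open>q\<close> is tangent. The values of \<open>P\<close> on these jets do not refer to a
  chart, and by \<open>leading_layer\<close> they determine the leading layer at \<open>(p,
  q)\<close>.\<close>
lemma leading_layer_chart_independent:
  assumes high: "layers_vanish_above b"
    and b: "b \<le> m" and x: "x \<in> polar_cone p q"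
  shows "\<exists>B. \<forall>i \<tau> G R. local_expression i \<tau> G R \<longrightarrow> x \<in> G \<longrightarrow>
     layer R m b (ratios i \<tau> x) (slope i \<tau> x p) (slope i \<tau> x q) = B"
proof -
  have x: "x \<noteq> 0" "F x = 0" "differential F x p = 0" "differential F x q = 0"
    using x by (auto simp: polar_cone_def)
  obtain r where r: "differential F x r = - hessian F x p" using differential_nonzero[OF x(1,2)] by blast
  obtain j where j: "partial j F x \<noteq> 0" using F_smooth[OF x(1,2)] by blast
  have "\<exists>c. has_jet c x p (r + of_nat n *s q) \<and> (\<forall>\<^sub>F t in nhds 0. F (c t) = 0)" for n :: nat
  proof -
    have "hessian F x p + differential F x (r + of_nat n *s q) = 0"
      by (simp add: differential_add differential_scale r x)
    from curve_with_jet[OF F_poly x(2) j x(3) this] show ?thesis by blast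
  qed
  then have "\<forall>n::nat. \<exists>c. has_jet c x p (r + of_nat n *s q) \<and> (\<forall>\<^sub>F t in nhds 0. F (c t) = 0)" ..
  from choice[OF this] obtain c where
    "\<forall>n::nat. has_jet (c n) x p (r + of_nat n *s q) \<and> (\<forall>\<^sub>F t in nhds 0. F (c n t) = 0)" ..
  then have c: "has_jet (c n) x p (r + of_nat n *s q)" "\<forall>\<^sub>F t in nhds 0. F (c n t) = 0" for n
    by simp_all
  define val where "val = (\<lambda>n. P (jet2 (\<lambda>t. pt (c n t))) / of_nat n ^ b)"
  have lim: "val \<longlonglongrightarrow> layer R m b (ratios i \<tau> x) (slope i \<tau> x p) (slope i \<tau> x q)"
    if D: "local_expression i \<tau> G R" "x \<in> G" for i \<tau> G R
  proof -
    define u where "u = slope i \<tau> x r - (2 * p $ i / x $ i) *s slope i \<tau> x p"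
    have "P (jet2 (\<lambda>t. pt (c n t))) = (\<Sum>b'\<le>m. layer R m b' (ratios i \<tau> x) (slope i \<tau> x p)
        (u + of_nat n *s slope i \<tau> x q))" for n
    proof -
      have "P (jet2 (\<lambda>t. pt (c n t))) = (\<Sum>b\<le>m. layer R m b (ratios i \<tau> x) (slope i \<tau> x p)
           (slope i \<tau> x (r + of_nat n *s q) - (2 * p $ i / x $ i) *s slope i \<tau> x p))"
        by (rule local_expressionD(6)[OF D(1) c(1) D(2) c(2)])
      moreover have "slope i \<tau> x (r + of_nat n *s q) - (2 * p $ i / x $ i) *s slope i \<tau> x p
          = u + of_nat n *s slope i \<tau> x q"
        by (simp add: u_def slope_add slope_scale)
      ultimately show ?thesis by simp
    qed
    moreover have "layer R m b' (ratios i \<tau> x) \<xi> \<eta> = 0" if "b < b'" "b' \<le> m" for b' \<xi> \<eta>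
      using high D x(2) that unfolding layers_vanish_above_def by blast
    ultimately show ?thesis unfolding val_def by (simp add: leading_layer b)
  qed
  then show ?thesis by (metis LIMSEQ_unique)
qed

text \<open>The leading layer is a function \<open>B\<close> on the polar cone that is locally the
  restriction of a holomorphic function and homogeneous of degree \<open>-(m - b) < 0\<close>. Let
  its modulus attain the maximum over the unit sphere at \<open>x0\<close>. On the hyperplane
  \<open>\<langle>x, x0\<rangle> = 1\<close> all other points have norm greater than
  \<open>1\<close>, so by homogeneity the modulus of \<open>B\<close> has a strict maximum at
  \<open>x0\<close> on this slice. The slice is the zero set of four functions in five variables,
  so \<open>no_strict_peak\<close> gives a contradiction unless \<open>B\<close> vanishes.\<close>
lemma leading_layer_on_polar_cone_zero:
  assumes m: "m \<ge> 1"
    and high: "layers_vanish_above b"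
    and b: "2 * b \<le> m"
    and D: "local_expression i \<tau> G R" "x \<in> G" "x \<in> polar_cone p q"
  shows "layer R m b (ratios i \<tau> x) (slope i \<tau> x p) (slope i \<tau> x q) = 0"
proof -
  have bm: "b \<le> m" and e: "m - b \<ge> 1" using b m by auto
  have "\<forall>x\<in>polar_cone p q. \<exists>B. \<forall>i \<tau> G R. local_expression i \<tau> G R \<longrightarrow> x \<in> G \<longrightarrow>
     layer R m b (ratios i \<tau> x) (slope i \<tau> x p) (slope i \<tau> x q) = B"
    by (intro ballI leading_layer_chart_independent high bm)
  from bchoice[OF this] obtain B where
    B_all: "\<forall>x\<in>polar_cone p q. \<forall>i \<tau> G R. local_expression i \<tau> G R \<longrightarrow> x \<in> G \<longrightarrow>
     layer R m b (ratios i \<tau> x) (slope i \<tau> x p) (slope i \<tau> x q) = B x" ..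
  have B: "layer R m b (ratios i \<tau> x) (slope i \<tau> x p) (slope i \<tau> x q) = B x"
    if "x \<in> polar_cone p q" "local_expression i \<tau> G R" "x \<in> G" for i \<tau> G R x
    by (rule B_all[rule_format, OF that])
  have D_ex: "\<exists>i \<tau> G R. local_expression i \<tau> G R \<and> x \<in> G" if "x \<in> polar_cone p q" for x
    using that local_expression_ex[of x] by (auto simp: polar_cone_def)
  have B_scale: "B (c *s x) = (1 / c) ^ (m - b) * B x" if x: "x \<in> polar_cone p q" and c: "c \<noteq> 0" for c x
  proof -
    obtain i \<tau> G R where D: "local_expression i \<tau> G R" "x \<in> G" using D_ex[OF x] by blast
    then have "c *s x \<in> G" using c by (blast intro: local_expressionD(3))
    then have "B (c *s x) = layer R m b (ratios i \<tau> (c *s x)) (slope i \<tau> (c *s x) p) (slope i \<tau> (c *s x) q)"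
      using B[OF polar_cone_scale[OF x c] D(1)] by simp
    also have "\<dots> = (1 / c) ^ (m - b) * B x"
      using B[OF x D] by (simp add: ratios_scale[OF c] slope_scale_point[OF c] layer_scale_both)
    finally show ?thesis .
  qed
  have "B x = 0"
  proof (rule ccontr)
    assume Bx: "B x \<noteq> 0"
    have B_cont: "continuous_on (polar_cone p q) B"
      unfolding continuous_on_eq_continuous_within
    proof
      fix y assume y: "y \<in> polar_cone p q"
      obtain i \<tau> G R where D: "local_expression i \<tau> G R" "y \<in> G" using D_ex[OF y] by blast
      define l where "l = (\<lambda>x. layer R m b (ratios i \<tau> x) (slope i \<tau> x p) (slope i \<tau> x q))"
      have "cdiff l y"
        unfolding l_def by (intro cdiff_layer local_expressionD(2,4)[OF D(1)] D(2))
      then have "isCont l y" by (rule cdiff_isCont)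
      then have "continuous (at y within polar_cone p q) l" by (rule continuous_at_imp_continuous_at_within)
      moreover obtain \<epsilon> where \<epsilon>: "\<epsilon> > 0" "ball y \<epsilon> \<subseteq> G"
        using local_expressionD(1)[OF D(1)] D(2) open_contains_ball by blast
      ultimately show "continuous (at y within polar_cone p q) B"
      proof (rule_tac continuous_transform_within[of y _ l \<epsilon>])
        show "l z = B z" if "z \<in> polar_cone p q" "dist z y < \<epsilon>" for z
          unfolding l_def using that \<epsilon>(2) by (intro B[OF _ D(1)]) (auto simp: dist_commute)
      qed (use y in auto)
    qed
    define K where "K = {z \<in> polar_cone p q. norm z = 1}"
    have normalize: "(1 / of_real (norm z)) *s z \<in> K" if "z \<in> polar_cone p q" for z
    proof -
      have "z \<noteq> 0" using that by (simp add: polar_cone_def)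
      then show ?thesis using polar_cone_scale[OF that, of "1 / of_real (norm z)"]
        by (simp add: K_def norm_scale_complex_vec norm_divide)
    qed
    have "compact K"
    proof -
      have "closed {z. F z = 0}" "closed {z. differential F z p = 0}" "closed {z. differential F z q = 0}"
        by (intro closed_Collect_eq cpoly_continuous continuous_on_const F_poly cpoly_differential)+
      then have "compact (sphere 0 1 \<inter> ({z. F z = 0} \<inter> {z. differential F z p = 0} \<inter> {z. differential F z q = 0}))"
        by (intro compact_Int_closed closed_Int) auto
      moreover have "sphere 0 1 \<inter> ({z. F z = 0} \<inter> {z. differential F z p = 0} \<inter> {z. differential F z q = 0}) = K"
        by (auto simp: K_def polar_cone_def)
      ultimately show ?thesis by simp
    qed
    moreover have "K \<noteq> {}" using normalize D(3) by blast
    moreover have "continuous_on K (\<lambda>z. norm (B z))"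
      by (intro continuous_on_norm continuous_on_subset[OF B_cont]) (auto simp: K_def)
    ultimately obtain x0 where x0: "x0 \<in> K" "\<And>z. z \<in> K \<Longrightarrow> norm (B z) \<le> norm (B x0)"
      using continuous_attains_sup[of K "\<lambda>z. norm (B z)"] by blast
    have x0Z: "x0 \<in> polar_cone p q" and x0n: "norm x0 = 1" using x0(1) by (auto simp: K_def)
    have B_le: "norm (B z) \<le> (1 / norm z) ^ (m - b) * norm (B x0)" if z: "z \<in> polar_cone p q" for z
    proof -
      have nz: "norm z > 0" using z by (simp add: polar_cone_def)
      have "norm (B ((1 / of_real (norm z)) *s z)) \<le> norm (B x0)" by (rule x0(2)[OF normalize[OF z]])
      then have "norm z ^ (m - b) * norm (B z) \<le> norm (B x0)"
        using nz by (subst (asm) B_scale[OF z]) (simp_all add: norm_mult norm_power)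
      then show ?thesis using nz by (simp add: power_one_over field_simps)
    qed
    have Bx0: "B x0 \<noteq> 0"
    proof
      assume "B x0 = 0"
      with B_le[OF D(3)] Bx show False by simp
    qed
    obtain i \<tau> G R where D0: "local_expression i \<tau> G R" "x0 \<in> G" using D_ex[OF x0Z] by blast
    define l where "l = (\<lambda>x. layer R m b (ratios i \<tau> x) (slope i \<tau> x p) (slope i \<tau> x q))"
    define h where "h = (\<lambda>z. (\<Sum>k\<in>UNIV. cnj (x0 $ k) * z $ k) - 1)"
    \<comment> \<open>Indices \<open>0\<close> to \<open>3\<close> carry the four equations of the slice; index \<open>4\<close> is the one that
        \<open>no_strict_peak\<close> ignores.\<close>
    define f :: "5 \<Rightarrow> complex^5 \<Rightarrow> complex" where
      "f = (\<lambda>i. if i = 0 then F else if i = 1 then (\<lambda>z. differential F z p)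
             else if i = 2 then (\<lambda>z. differential F z q) else h)"
    have h_poly: "cpoly h" unfolding h_def
      by (intro cpoly_diff cpoly_sum cpoly.cpoly_mult cpoly.cpoly_const cpoly.cpoly_coord)
    have hx0: "h x0 = 0" using x0n norm_complex_vec[of x0] by (simp add: h_def)
    have neq: "(0::5) \<noteq> 4" "(1::5) \<noteq> 4" "(2::5) \<noteq> 4" "(3::5) \<noteq> 4" "(1::5) \<noteq> 0" "(2::5) \<noteq> 0" "(2::5) \<noteq> 1"
       "(3::5) \<noteq> 0" "(3::5) \<noteq> 1" "(3::5) \<noteq> 2" by simp_all
    show False
    proof (rule no_strict_peak[of f 4 x0 G l])
      show "cpoly (f i)" for i
        using F_poly cpoly_differential[OF F_poly] h_poly by (simp add: f_def)
      show "f i x0 = 0" for i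
        using x0Z hx0 by (simp add: f_def polar_cone_def)
      show "open G" by (rule local_expressionD(1)[OF D0(1)])
      show "cdiff l z" if "z \<in> G" for z
        unfolding l_def by (intro cdiff_layer local_expressionD(2,4)[OF D0(1)] that)
      have lB: "l z = B z" if "z \<in> G" "z \<in> polar_cone p q" for z
        unfolding l_def by (rule B[OF that(2) D0(1) that(1)])
      show "l x0 \<noteq> 0" using lB D0(2) x0Z Bx0 by simp
      fix z assume z: "z \<in> G" "z \<noteq> x0" and f0: "\<And>i. i \<noteq> 4 \<Longrightarrow> f i z = 0"
      have hz: "h z = 0" and Fz: "F z = 0" "differential F z p = 0" "differential F z q = 0"
        using f0[of 0] f0[of 1] f0[of 2] f0[of 3] neq by (simp_all add: f_def)
      have "z \<noteq> 0" using hz by (auto simp: h_def)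
      with Fz have zZ: "z \<in> polar_cone p q" by (simp add: polar_cone_def)
      have "norm z > 1"
        by (rule norm_gt_1_on_tangent_plane[OF x0n _ z(2)]) (use hz in \<open>simp add: h_def\<close>)
      then have n0: "0 < norm z" "1 / norm z < 1" by (linarith, simp add: divide_less_eq)
      then have "(1 / norm z) ^ (m - b) < 1"
        using e power_strict_decreasing[of 0 "m - b" "1 / norm z"] by simp
      then have "(1 / norm z) ^ (m - b) * norm (B x0) < 1 * norm (B x0)"
        using Bx0 by (intro mult_strict_right_mono) auto
      then have "norm (B z) < norm (B x0)" using B_le[OF zZ] by simp
      then show "norm (l z) < norm (l x0)" using lB z(1) zZ D0(2) x0Z by simp
    qed (use D0 in auto)
  qed
  then show ?thesis using B[OF D(3,1,2)] by simp
qed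

text \<open>Downward induction on \<open>b\<close>: in a local expression the slopes of tangent
  vectors take all values, so the vanishing of the leading layer on all polar cones is its
  vanishing as a polynomial.\<close>
lemma layers_zero:
  assumes m: "m \<ge> 1" and "local_expression i \<tau> G R" "x \<in> G" "F x = 0" "b \<le> m"
  shows "layer R m b (ratios i \<tau> x) \<xi> \<eta> = 0"
  using assms(2-)
proof (induction "m - b" arbitrary: b i \<tau> G R x \<xi> \<eta> rule: less_induct)
  case less
  show ?case
  proof (cases "2 * b \<le> m")
    case True
    obtain p where p: "differential F x p = 0" "slope i \<tau> x p = \<xi>"
      using local_expressionD(5)[OF less.prems(1-3)] by blast
    obtain q where q: "differential F x q = 0" "slope i \<tau> x q = \<eta>"
      using local_expressionD(5)[OF less.prems(1-3)] by blast
    have "x \<noteq> 0" using local_expressionD(2)[OF less.prems(1,2)] by auto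
    then have "x \<in> polar_cone p q" using p q less.prems(3) by (simp add: polar_cone_def)
    moreover have "layers_vanish_above b"
      unfolding layers_vanish_above_def
    proof (intro allI impI)
      fix b' i \<tau> G R x \<xi> \<eta>
      assume "b < b'" "b' \<le> m" "local_expression i \<tau> G R" "x \<in> G" "F x = 0"
      then show "layer R m b' (ratios i \<tau> x) \<xi> \<eta> = 0"
        by (intro less.hyps[where b = b']) simp_all
    qed
    ultimately have "layer R m b (ratios i \<tau> x) (slope i \<tau> x p) (slope i \<tau> x q) = 0"
      by (intro leading_layer_on_polar_cone_zero[OF m _ True less.prems(1,2)])
    then show ?thesis by (simp add: p q)
  qed (simp add: layer_empty)
qed

lemma points_hypersurface: "points (hypersurface_atlas X) \<subseteq> X"
  unfolding points_def hypersurface_atlas_def submanifold_atlas_def by auto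

lemma vanishes:
  assumes "m \<ge> 1"
  shows "P = (\<lambda>_. 0)"
proof
  fix \<xi>
  show "P \<xi> = 0"
  proof (cases "\<xi> \<in> jets_over (hypersurface_atlas X) 2 (points (hypersurface_atlas X))")
    case True
    then obtain f where f: "curve_germ (hypersurface_atlas X) f" "f 0 \<in> points (hypersurface_atlas X)"
      "\<xi> = jet2 f" by (auto simp: jets_over_def)
    obtain x where x: "x \<noteq> 0" "F x = 0" "f 0 = pt x" using f(2) points_hypersurface X_cases by blast
    obtain i \<tau> G R where D: "local_expression i \<tau> G R" "x \<in> G" using local_expression_ex[OF x(1,2)] by blast
    obtain \<xi>' \<eta> where "P (jet2 f) = (\<Sum>b\<le>m. layer R m b (ratios i \<tau> x) \<xi>' \<eta>)"
      using local_expressionD(7)[OF D(1) f(1) x(3) D(2) x(2)] by blast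
    also have "\<dots> = 0" by (rule sum.neutral) (use layers_zero[OF assms D x(2)] in auto)
    finally show ?thesis by (simp add: f(3))
  next
    case False
    then show ?thesis
      using P unfolding global_jet_differentials_def invariant_jet_differentials_def by blast
  qed
qed

end

lemma zero_jet_differential: "(\<lambda>_. 0) \<in> global_jet_differentials A k m"
proof -
  have "holo_on (\<lambda>_. 0) S" for S :: "(complex^'n) set" by (auto simp: holo_on_cdiff)
  then show ?thesis
    unfolding global_jet_differentials_def invariant_jet_differentials_def
    by (auto intro!: exI[of _ "\<lambda>_ _. 0"])
qed

theorem mainTheorem1:
  fixes X :: "(complex^5) set set" and d m :: nat
  assumes "smooth_hypersurface d X" and "d \<ge> 2" and "m \<ge> 1"
  shows "global_jet_differentials (hypersurface_atlas X) 2 m = {\<lambda>_. 0}"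
proof (intro equalityI subsetI)
  obtain F where F: "homogeneous_poly d F" "\<forall>z. z \<noteq> 0 \<and> F z = 0 \<longrightarrow> (\<exists>i. partial i F z \<noteq> 0)"
    "X = {L \<in> proj_space. \<forall>z\<in>L. F z = 0}"
    using assms(1) by (auto simp: smooth_hypersurface_def)
  fix P assume "P \<in> global_jet_differentials (hypersurface_atlas X) 2 m"
  then interpret jet_differential F d X P m
    using F by unfold_locales auto
  show "P \<in> {\<lambda>_. 0}" using vanishes[OF assms(3)] by simp
qed (simp add: zero_jet_differential)

end
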